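(* Let $P$ be Thompson's quandle, with generators $p_0,p_1,p_2,\dots$, and for $j\geqslant 0$ let $P_j$ be the subquandle of $P$ generated by the $p_k$ with $k\geqslant j$. For $j\geqslant 1$ let $\tau_j\colon P_j\to P_{j+1}$ be the isomorphism of quandles with $\tau_j(p_k)=p_{k+1}$ for all $k\geqslant j$. Then for every $j\geqslant 1$ the HNN extension $P_j*\tau_j$ is isomorphic to $P_{j-1}$. In particular $P=P_0\cong P_1*\tau_1$, and, iterating, for every $n\geqslant 1$ the quandle $P$ is obtained up to isomorphism from $P_n\cong P$ by $n$ successive HNN extensions of this form. Equivalently, $P*\tau\cong P$, where $\tau\colon P=P_0\to P_1$ is the isomorphism with $\tau(p_k)=p_{k+1}$ for all $k\geqslant 0$.
   Context: A quandle is a set $Q$ with a binary operation $\rhd$ such that for every $x\in Q$ the left multiplication $y\mapsto x\rhd y$ is bijective, $x\rhd(y\rhd z)=(x\rhd y)\rhd(x\rhd z)$ for all $x,y,z$, and $x\rhd x=x$ for all $x$. Thompson's quandle $P$ is the quandle with generators $p_0,p_1,p_2,\dots$ and relations $p_j\rhd p_k=p_{k+1}$ for all $0\leqslant j<k$. A subquandle is a subset closed under $\rhd$ and under the inverses of left multiplications by its elements. Shifting indices $p_k\leftrightarrow p_{k-j}$ gives isomorphisms $P_j\cong P_0=P$ for all $j$. HNN extension of quandles: if $Q=\langle S\mid R\rangle$ is a quandle given by a presentation, and $\tau\colon U\to V$ is an isomorphism between subquandles $U$ and $V$ of $Q$, then the HNN extension of $Q$ by $\tau$ is the quandle $Q*\tau=\langle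 S\cup\{t\}\mid R\cup\{t\rhd u=\tau(u)\mid u\in U\}\rangle$, where $t$ is a new generator. Here $V=P_{j+1}$ is a subquandle of $Q=U=P_j$. *)

theory Defs
  imports Main
begin

record 'a quandle_struct =
  carrier :: "'a set"
  lact :: "'a \<Rightarrow> 'a \<Rightarrow> 'a" (infixl \<open>\<rhd>\<index>\<close> 70)

locale quandle =
  fixes Q (structure)
  assumes lact_bij: "x \<in> carrier Q \<Longrightarrow> bij_betw (\<lambda>y. x \<rhd> y) (carrier Q) (carrier Q)"
    and lact_distrib: "\<lbrakk>x \<in> carrier Q; y \<in> carrier Q; z \<in> carrier Q\<rbrakk>
      \<Longrightarrow> x \<rhd> (y \<rhd> z) = (x \<rhd> y) \<rhd> (x \<rhd> z)"
    and lact_idem: "x \<in> carrier Q \<Longrightarrow> x \<rhd> x = x"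

definition ldiv :: "('a, 'm) quandle_struct_scheme \<Rightarrow> 'a \<Rightarrow> 'a \<Rightarrow> 'a" where
  "ldiv Q x y = inv_into (carrier Q) (\<lambda>z. x \<rhd>\<^bsub>Q\<^esub> z) y"

definition subquandle :: "'a set \<Rightarrow> ('a, 'm) quandle_struct_scheme \<Rightarrow> bool" where
  "subquandle U Q \<longleftrightarrow> U \<subseteq> carrier Q \<and>
     (\<forall>x\<in>U. \<forall>y\<in>U. x \<rhd>\<^bsub>Q\<^esub> y \<in> U \<and> ldiv Q x y \<in> U)"

definition subquandle_generated :: "('a, 'm) quandle_struct_scheme \<Rightarrow> 'a set \<Rightarrow> 'a set" where
  "subquandle_generated Q A = \<Inter>{U. subquandle U Q \<and> A \<subseteq> U}"

definition quandle_iso ::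
  "('a \<Rightarrow> 'b) \<Rightarrow> ('a, 'm) quandle_struct_scheme \<Rightarrow> ('b, 'n) quandle_struct_scheme \<Rightarrow> bool" where
  "quandle_iso f Q Q' \<longleftrightarrow> bij_betw f (carrier Q) (carrier Q') \<and>
     (\<forall>x\<in>carrier Q. \<forall>y\<in>carrier Q. f (x \<rhd>\<^bsub>Q\<^esub> y) = f x \<rhd>\<^bsub>Q'\<^esub> f y)"

definition quandle_isomorphic ::
  "('a, 'm) quandle_struct_scheme \<Rightarrow> ('b, 'n) quandle_struct_scheme \<Rightarrow> bool"
  (infix \<open>\<cong>\<^sub>q\<close> 50) where
  "Q \<cong>\<^sub>q Q' \<longleftrightarrow> (\<exists>f. quandle_iso f Q Q')"

text \<open>Words in the generators; \<open>Act a b\<close> stands for the action of \<open>a\<close> on \<open>b\<close>, and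
  \<open>Unact a b\<close> for the image of \<open>b\<close> under the inverse of the left multiplication by \<open>a\<close>.\<close>

datatype (gens_of: 'g) qterm =
  Gen 'g
| Act "'g qterm" "'g qterm"
| Unact "'g qterm" "'g qterm"

record 'g qpres =
  generators :: "'g set"
  relations :: "('g qterm \<times> 'g qterm) set"

definition terms_over :: "'g set \<Rightarrow> 'g qterm set" where
  "terms_over S = {w. gens_of w \<subseteq> S}"

definition wf_pres :: "'g qpres \<Rightarrow> bool" where
  "wf_pres X \<longleftrightarrow> relations X \<subseteq> terms_over (generators X) \<times> terms_over (generators X)"

inductive qeq :: "'g qpres \<Rightarrow> 'g qterm \<Rightarrow> 'g qterm \<Rightarrow> bool" for X where
  qeq_rel: "\<lbrakk>(a, b) \<in> relations X; a \<in> terms_over (generators X); b \<in> terms_over (generators X)\<rbrakk>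
    \<Longrightarrow> qeq X a b"
| qeq_refl: "a \<in> terms_over (generators X) \<Longrightarrow> qeq X a a"
| qeq_sym: "qeq X a b \<Longrightarrow> qeq X b a"
| qeq_trans: "\<lbrakk>qeq X a b; qeq X b c\<rbrakk> \<Longrightarrow> qeq X a c"
| qeq_cong_Act: "\<lbrakk>qeq X a a'; qeq X b b'\<rbrakk> \<Longrightarrow> qeq X (Act a b) (Act a' b')"
| qeq_cong_Unact: "\<lbrakk>qeq X a a'; qeq X b b'\<rbrakk> \<Longrightarrow> qeq X (Unact a b) (Unact a' b')"
| qeq_Act_Unact: "\<lbrakk>a \<in> terms_over (generators X); b \<in> terms_over (generators X)\<rbrakk>
    \<Longrightarrow> qeq X (Act a (Unact a b)) b"
| qeq_Unact_Act: "\<lbrakk>a \<in> terms_over (generators X); b \<in> terms_over (generators X)\<rbrakk>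
    \<Longrightarrow> qeq X (Unact a (Act a b)) b"
| qeq_distrib: "\<lbrakk>a \<in> terms_over (generators X); b \<in> terms_over (generators X);
      c \<in> terms_over (generators X)\<rbrakk>
    \<Longrightarrow> qeq X (Act a (Act b c)) (Act (Act a b) (Act a c))"
| qeq_idem: "a \<in> terms_over (generators X) \<Longrightarrow> qeq X (Act a a) a"

definition qclass :: "'g qpres \<Rightarrow> 'g qterm \<Rightarrow> 'g qterm set" where
  "qclass X a = {b. qeq X a b}"

definition presented :: "'g qpres \<Rightarrow> 'g qterm set quandle_struct" where
  "presented X = \<lparr>carrier = qclass X ` terms_over (generators X),
     lact = (\<lambda>A B. \<Union>a\<in>A. \<Union>b\<in>B. qclass X (Act a b))\<rparr>"

text \<open>\<open>X\<close> is a presentation of \<open>Q\<close>, where \<open>\<theta>\<close> tells which elements of \<open>Q\<close> the words represent.\<close>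

definition presents ::
  "'g qpres \<Rightarrow> ('g qterm set \<Rightarrow> 'a) \<Rightarrow> ('a, 'm) quandle_struct_scheme \<Rightarrow> bool" where
  "presents X \<theta> Q \<longleftrightarrow> wf_pres X \<and> quandle_iso \<theta> (presented X) Q"

lemma qeq_terms: "qeq X a b \<Longrightarrow> a \<in> terms_over (generators X) \<and> b \<in> terms_over (generators X)"
  by (induction rule: qeq.induct) (auto simp: terms_over_def)

lemma qclass_eq_iff:
  assumes "a \<in> terms_over (generators X)"
  shows "qclass X a = qclass X b \<longleftrightarrow> qeq X a b"
proof
  assume eq: "qclass X a = qclass X b"
  have "a \<in> qclass X a"
    using assms by (simp add: qclass_def qeq_refl)
  then have "qeq X b a"
    unfolding eq by (simp add: qclass_def)
  then show "qeq X a b"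
    by (rule qeq_sym)
next
  assume ab: "qeq X a b"
  have "qeq X a c \<longleftrightarrow> qeq X b c" for c
  proof
    show "qeq X b c" if "qeq X a c"
      by (rule qeq_trans[OF qeq_sym[OF ab] that])
    show "qeq X a c" if "qeq X b c"
      by (rule qeq_trans[OF ab that])
  qed
  then show "qclass X a = qclass X b"
    by (simp add: qclass_def)
qed

lemma presented_lact:
  assumes a: "a \<in> terms_over (generators X)" and b: "b \<in> terms_over (generators X)"
  shows "qclass X a \<rhd>\<^bsub>presented X\<^esub> qclass X b = qclass X (Act a b)"
proof -
  have ab: "Act a b \<in> terms_over (generators X)"
    using a b by (simp add: terms_over_def)
  have *: "qclass X (Act a' b') = qclass X (Act a b)" if "a' \<in> qclass X a" "b' \<in> qclass X b" for a' b'
  proof -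
    have "qeq X (Act a b) (Act a' b')"
      using that by (simp add: qclass_def qeq_cong_Act)
    then show ?thesis
      using qclass_eq_iff[OF ab, of "Act a' b'"] by simp
  qed
  have mem: "a \<in> qclass X a" "b \<in> qclass X b"
    using a b by (simp_all add: qclass_def qeq_refl)
  have "(\<Union>a'\<in>qclass X a. \<Union>b'\<in>qclass X b. qclass X (Act a' b'))
      = (\<Union>a'\<in>qclass X a. \<Union>b'\<in>qclass X b. qclass X (Act a b))"
    by (rule SUP_cong[OF refl], rule SUP_cong[OF refl], rule *)
  also have "\<dots> = qclass X (Act a b)"
    using mem by blast
  finally show ?thesis
    by (simp add: presented_def)
qed

lemma presented_carrier: "carrier (presented X) = qclass X ` terms_over (generators X)"
  by (simp add: presented_def)

lemma terms_over_simps [simp]: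
  "Gen g \<in> terms_over S \<longleftrightarrow> g \<in> S"
  "Act a b \<in> terms_over S \<longleftrightarrow> a \<in> terms_over S \<and> b \<in> terms_over S"
  "Unact a b \<in> terms_over S \<longleftrightarrow> a \<in> terms_over S \<and> b \<in> terms_over S"
  by (auto simp: terms_over_def)

lemma quandle_presented: "quandle (presented X)"
proof
  fix A assume "A \<in> carrier (presented X)"
  then obtain a where a: "a \<in> terms_over (generators X)" "A = qclass X a"
    by (auto simp: presented_carrier)
  show "A \<rhd>\<^bsub>presented X\<^esub> A = A"
    using a by (simp add: presented_lact qclass_eq_iff qeq_idem)
  show "bij_betw (\<lambda>B. A \<rhd>\<^bsub>presented X\<^esub> B) (carrier (presented X)) (carrier (presented X))"
    unfolding bij_betw_def
  proof
    show "inj_on (\<lambda>B. A \<rhd>\<^bsub>presented X\<^esub> B) (carrier (presented X))"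
    proof (rule inj_onI)
      fix B C assume "B \<in> carrier (presented X)" "C \<in> carrier (presented X)"
        and eq: "A \<rhd>\<^bsub>presented X\<^esub> B = A \<rhd>\<^bsub>presented X\<^esub> C"
      then obtain b c where bc: "b \<in> terms_over (generators X)" "B = qclass X b"
        "c \<in> terms_over (generators X)" "C = qclass X c"
        by (auto simp: presented_carrier)
      have "qeq X (Act a b) (Act a c)"
        using eq a bc by (simp add: presented_lact qclass_eq_iff)
      then have "qeq X (Unact a (Act a b)) (Unact a (Act a c))"
        using a by (simp add: qeq_cong_Unact qeq_refl)
      then have "qeq X b c"
        
        by (rule qeq_trans[OF qeq_trans[OF qeq_sym[OF qeq_Unact_Act[OF a(1) bc(1)]]] qeq_Unact_Act[OF a(1) bc(3)]])
      then show "B = C" using bc by (simp add: qclass_eq_iff)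
    qed
    show "(\<lambda>B. A \<rhd>\<^bsub>presented X\<^esub> B) ` carrier (presented X) = carrier (presented X)"
    proof
      show "(\<lambda>B. A \<rhd>\<^bsub>presented X\<^esub> B) ` carrier (presented X) \<subseteq> carrier (presented X)"
        using a by (auto simp: presented_carrier presented_lact)
      show "carrier (presented X) \<subseteq> (\<lambda>B. A \<rhd>\<^bsub>presented X\<^esub> B) ` carrier (presented X)"
      proof
        fix B assume "B \<in> carrier (presented X)"
        then obtain b where b: "b \<in> terms_over (generators X)" "B = qclass X b"
          by (auto simp: presented_carrier)
        have "A \<rhd>\<^bsub>presented X\<^esub> qclass X (Unact a b) = B"
          using a b by (simp add: presented_lact qclass_eq_iff qeq_Act_Unact)
        moreover have "qclass X (Unact a b) \<in> carrier (presented X)"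
          using a b by (simp add: presented_carrier)
        ultimately show "B \<in> (\<lambda>B. A \<rhd>\<^bsub>presented X\<^esub> B) ` carrier (presented X)"
          by blast
      qed
    qed
  qed
next
  fix A B C
  assume "A \<in> carrier (presented X)" "B \<in> carrier (presented X)" "C \<in> carrier (presented X)"
  then obtain a b c where abc: "a \<in> terms_over (generators X)" "A = qclass X a"
    "b \<in> terms_over (generators X)" "B = qclass X b"
    "c \<in> terms_over (generators X)" "C = qclass X c"
    by (auto simp: presented_carrier)
  then show "A \<rhd>\<^bsub>presented X\<^esub> (B \<rhd>\<^bsub>presented X\<^esub> C)
      = (A \<rhd>\<^bsub>presented X\<^esub> B) \<rhd>\<^bsub>presented X\<^esub> (A \<rhd>\<^bsub>presented X\<^esub> C)"
    by (simp add: presented_lact qclass_eq_iff qeq_distrib)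
qed

text \<open>The presentation of the HNN extension of \<open>Q\<close> by \<open>\<tau>\<close>, an isomorphism from the subquandle
  \<open>U\<close> of \<open>Q\<close> onto another one, where \<open>presents X \<theta> Q\<close> and \<open>t\<close> is not a generator of \<open>X\<close>.
  A relation between elements of \<open>Q\<close> is imposed on all words representing them.\<close>

definition hnn_pres ::
  "'g qpres \<Rightarrow> ('g qterm set \<Rightarrow> 'a) \<Rightarrow> 'a set \<Rightarrow> ('a \<Rightarrow> 'a) \<Rightarrow> 'g \<Rightarrow> 'g qpres" where
  "hnn_pres X \<theta> U \<tau> t =
     \<lparr>generators = insert t (generators X),
      relations = relations X \<union>
        {(Act (Gen t) a, b) | a b.
           a \<in> terms_over (generators X) \<and> b \<in> terms_over (generators X) \<and>
           \<theta> (qclass X a) \<in> U \<and> \<theta> (qclass X b) = \<tau> (\<theta> (qclass X a))}\<rparr>"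

definition thompson_pres :: "nat qpres" where
  "thompson_pres =
     \<lparr>generators = UNIV, relations = {(Act (Gen j) (Gen k), Gen (k + 1)) | j k. j < k}\<rparr>"

definition thompson :: "nat qterm set quandle_struct" where
  "thompson = presented thompson_pres"

definition pgen :: "nat \<Rightarrow> nat qterm set" where
  "pgen k = qclass thompson_pres (Gen k)"

definition thompson_sub :: "nat \<Rightarrow> nat qterm set quandle_struct" where
  "thompson_sub j = thompson\<lparr>carrier := subquandle_generated thompson {pgen k | k. j \<le> k}\<rparr>"

definition thompson_shift :: "nat \<Rightarrow> (nat qterm set \<Rightarrow> nat qterm set) \<Rightarrow> bool" where
  "thompson_shift j \<tau> \<longleftrightarrow> quandle_iso \<tau> (thompson_sub j) (thompson_sub (j + 1)) \<and>
     (\<forall>k\<ge>j. \<tau> (pgen k) = pgen (k + 1))"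

text \<open>A tower of \<open>n\<close> successive HNN extensions starting with \<open>P\<^sub>n\<close>: the \<open>i\<close>-th quandle
  \<open>presented (X i)\<close> is identified with \<open>P\<^sub>n\<^sub>-\<^sub>i\<close> by means of \<open>\<theta> i\<close> and is then extended by
  \<open>\<tau> (n - i)\<close>, with new generator \<open>t i\<close>.\<close>

definition thompson_hnn_tower ::
  "nat \<Rightarrow> (nat \<Rightarrow> nat qterm set \<Rightarrow> nat qterm set) \<Rightarrow> (nat \<Rightarrow> 'g qpres) \<Rightarrow>
   (nat \<Rightarrow> 'g qterm set \<Rightarrow> nat qterm set) \<Rightarrow> (nat \<Rightarrow> 'g) \<Rightarrow> bool" where
  "thompson_hnn_tower n \<tau> X \<theta> t \<longleftrightarrow>
     (\<forall>i<n. presents (X i) (\<theta> i) (thompson_sub (n - i)) \<and> t i \<notin> generators (X i) \<and>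
        X (Suc i) = hnn_pres (X i) (\<theta> i) (carrier (thompson_sub (n - i))) (\<tau> (n - i)) (t i))"

end

theory Submission
  imports Defs Complex_Main
begin

text \<open>Adding to the presentation of \<open>P\<^sub>1\<close> a generator \<open>p\<^sub>0\<close> that acts on \<open>P\<^sub>1\<close> as the shift
  \<open>p\<^sub>k \<mapsto> p\<^sub>k\<^sub>+\<^sub>1\<close> gives Thompson's quandle back, because the relations of \<open>P\<close> that involve
  \<open>p\<^sub>0\<close> say just that. Everything then hinges on one fact: the shift, which is obviously an
  endomorphism of \<open>P\<close>, is injective. It identifies \<open>P\<close> with every \<open>P\<^sub>j\<close>, so that one
  computation covers all \<open>j\<close>, including the extension \<open>P * \<tau>\<close> (\<open>hnn_pres_isomorphic\<close>).
  There \<open>P\<close> and the HNN extension receive homomorphisms into each other from their universal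
  properties, and these are mutually inverse since they are so on generators.

  Injectivity of the shift cannot be read off the presentation: a priori two elements of
  \<open>P\<^sub>1\<close> might be equal only because of relations that involve \<open>p\<^sub>0\<close>. It is obtained from a
  faithful model. Let \<open>p\<^sub>k\<close> be the piecewise linear map of the line that is the identity up to
  \<open>k\<close>, has slope 2 on \<open>[k, k + 1]\<close>, and is \<open>y \<mapsto> y + 1\<close> beyond; the operation becomes conjugation
  of bijections. In this model the shift is conjugation by a translation, hence injective, so
  that it suffices to prove that the model is faithful (\<open>rep_inj\<close>).

  For this, let words in the generators act on \<open>P\<close> through left multiplications. Any two words
  have a common left multiple (\<open>common_left_multiple\<close>), and therefore any two elements can be
  moved by one word to elements of the form \<open>w \<cdot> p\<^sub>k\<close> with \<open>w\<close> a word
  (\<open>exists_denominator\<close>, \<open>common_denominator\<close>). Letters \<open>i \<le> k\<close> can be absorbed into \<open>p\<^sub>k\<close>, and the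
  others can be sorted, which leaves a normal form (\<open>positive_normal_form\<close>). Finally the map of
  the line represented by a normal form determines \<open>k\<close> and \<open>w\<close> (\<open>rep_inj_positive\<close>).\<close>

section \<open>Homomorphisms and interpretations of words\<close>

context quandle
begin

lemma lact_closed: "x \<in> carrier Q \<Longrightarrow> y \<in> carrier Q \<Longrightarrow> x \<rhd> y \<in> carrier Q"
  using lact_bij[of x] by (auto simp: bij_betw_def)

lemma lact_cancel:
  "\<lbrakk>x \<rhd> y = x \<rhd> z; x \<in> carrier Q; y \<in> carrier Q; z \<in> carrier Q\<rbrakk> \<Longrightarrow> y = z"
  using lact_bij[of x] by (auto simp: bij_betw_def inj_on_def)

lemma ldiv_closed: "x \<in> carrier Q \<Longrightarrow> y \<in> carrier Q \<Longrightarrow> ldiv Q x y \<in> carrier Q"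
  using lact_bij[of x] unfolding ldiv_def bij_betw_def by (metis inv_into_into)

lemma lact_ldiv: "x \<in> carrier Q \<Longrightarrow> y \<in> carrier Q \<Longrightarrow> x \<rhd> ldiv Q x y = y"
  using lact_bij[of x] unfolding ldiv_def bij_betw_def by (metis f_inv_into_f)

lemma ldiv_eqI:
  "\<lbrakk>x \<rhd> z = y; x \<in> carrier Q; z \<in> carrier Q\<rbrakk> \<Longrightarrow> ldiv Q x y = z"
  by (metis lact_cancel lact_closed lact_ldiv ldiv_closed)

lemma quandle_subquandle:
  assumes "subquandle U Q"
  shows "quandle (Q\<lparr>carrier := U\<rparr>)"
proof
  have U: "x \<in> carrier Q" if "x \<in> U" for x
    using assms that by (auto simp: subquandle_def)
  fix x assume "x \<in> carrier (Q\<lparr>carrier := U\<rparr>)"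
  then have x: "x \<in> U" by simp
  show "bij_betw (\<lambda>y. x \<rhd>\<^bsub>Q\<lparr>carrier := U\<rparr>\<^esub> y) (carrier (Q\<lparr>carrier := U\<rparr>)) (carrier (Q\<lparr>carrier := U\<rparr>))"
    unfolding bij_betw_def
  proof
    show "inj_on (\<lambda>y. x \<rhd>\<^bsub>Q\<lparr>carrier := U\<rparr>\<^esub> y) (carrier (Q\<lparr>carrier := U\<rparr>))"
      using x U by (auto intro!: inj_onI dest: lact_cancel)
    have "y \<in> (\<lambda>y. x \<rhd> y) ` U" if "y \<in> U" for y
      using assms x that U by (intro image_eqI[of _ _ "ldiv Q x y"]) (auto simp: subquandle_def lact_ldiv)
    then show "(\<lambda>y. x \<rhd>\<^bsub>Q\<lparr>carrier := U\<rparr>\<^esub> y) ` carrier (Q\<lparr>carrier := U\<rparr>) = carrier (Q\<lparr>carrier := U\<rparr>)"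
      using assms x by (auto simp: subquandle_def)
  qed
  show "x \<rhd>\<^bsub>Q\<lparr>carrier := U\<rparr>\<^esub> x = x"
    using x U by (simp add: lact_idem)
next
  fix x y z
  assume "x \<in> carrier (Q\<lparr>carrier := U\<rparr>)" "y \<in> carrier (Q\<lparr>carrier := U\<rparr>)" "z \<in> carrier (Q\<lparr>carrier := U\<rparr>)"
  then have "x \<in> carrier Q" "y \<in> carrier Q" "z \<in> carrier Q"
    using assms by (auto simp: subquandle_def)
  then show "x \<rhd>\<^bsub>Q\<lparr>carrier := U\<rparr>\<^esub> (y \<rhd>\<^bsub>Q\<lparr>carrier := U\<rparr>\<^esub> z) =
      (x \<rhd>\<^bsub>Q\<lparr>carrier := U\<rparr>\<^esub> y) \<rhd>\<^bsub>Q\<lparr>carrier := U\<rparr>\<^esub> (x \<rhd>\<^bsub>Q\<lparr>carrier := U\<rparr>\<^esub> z)"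
    by (simp add: lact_distrib)
qed

end

definition quandle_hom ::
  "('a \<Rightarrow> 'b) \<Rightarrow> ('a, 'm) quandle_struct_scheme \<Rightarrow> ('b, 'n) quandle_struct_scheme \<Rightarrow> bool" where
  "quandle_hom f Q Q' \<longleftrightarrow> (\<forall>x\<in>carrier Q. f x \<in> carrier Q') \<and>
     (\<forall>x\<in>carrier Q. \<forall>y\<in>carrier Q. f (x \<rhd>\<^bsub>Q\<^esub> y) = f x \<rhd>\<^bsub>Q'\<^esub> f y)"

lemma quandle_hom_closed: "quandle_hom f Q Q' \<Longrightarrow> x \<in> carrier Q \<Longrightarrow> f x \<in> carrier Q'"
  by (simp add: quandle_hom_def)

lemma quandle_hom_lact:
  "\<lbrakk>quandle_hom f Q Q'; x \<in> carrier Q; y \<in> carrier Q\<rbrakk> \<Longrightarrow> f (x \<rhd>\<^bsub>Q\<^esub> y) = f x \<rhd>\<^bsub>Q'\<^esub> f y"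
  by (simp add: quandle_hom_def)

lemma quandle_hom_ldiv:
  assumes "quandle Q" "quandle Q'" "quandle_hom f Q Q'" "x \<in> carrier Q" "y \<in> carrier Q"
  shows "f (ldiv Q x y) = ldiv Q' (f x) (f y)"
proof (rule quandle.ldiv_eqI[OF assms(2), symmetric])
  note cl = quandle_hom_closed[OF assms(3)]
  show "f x \<in> carrier Q'" "f (ldiv Q x y) \<in> carrier Q'"
    using assms(4,5) by (auto intro!: cl quandle.ldiv_closed[OF assms(1)])
  show "f x \<rhd>\<^bsub>Q'\<^esub> f (ldiv Q x y) = f y"
    using assms(4,5)
    by (simp add: quandle_hom_lact[OF assms(3), symmetric] quandle.lact_ldiv[OF assms(1)]
        quandle.ldiv_closed[OF assms(1)])
qed

lemma quandle_hom_comp: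
  "quandle_hom f Q Q' \<Longrightarrow> quandle_hom g Q' Q'' \<Longrightarrow> quandle_hom (\<lambda>x. g (f x)) Q Q''"
  by (simp add: quandle_hom_def)

lemma quandle_iso_imp_hom: "quandle_iso f Q Q' \<Longrightarrow> quandle_hom f Q Q'"
  unfolding quandle_hom_def quandle_iso_def by (meson bij_betw_apply)

lemma quandle_iso_inv:
  assumes "quandle Q" "quandle_iso f Q Q'"
  shows "quandle_iso (inv_into (carrier Q) f) Q' Q"
proof -
  have bij: "bij_betw f (carrier Q) (carrier Q')"
    and lact: "\<And>x y. x \<in> carrier Q \<Longrightarrow> y \<in> carrier Q \<Longrightarrow> f (x \<rhd>\<^bsub>Q\<^esub> y) = f x \<rhd>\<^bsub>Q'\<^esub> f y"
    using assms by (auto simp: quandle_iso_def)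
  show ?thesis
    unfolding quandle_iso_def
  proof (intro conjI ballI)
    show "bij_betw (inv_into (carrier Q) f) (carrier Q') (carrier Q)"
      by (rule bij_betw_inv_into[OF bij])
    fix x y assume "x \<in> carrier Q'" "y \<in> carrier Q'"
    then obtain x' y' where "x' \<in> carrier Q" "y' \<in> carrier Q" "x = f x'" "y = f y'"
      using bij by (metis bij_betw_imp_surj_on imageE)
    then show "inv_into (carrier Q) f (x \<rhd>\<^bsub>Q'\<^esub> y)
        = inv_into (carrier Q) f x \<rhd>\<^bsub>Q\<^esub> inv_into (carrier Q) f y"
      using bij by (simp add: lact[symmetric] quandle.lact_closed[OF assms(1)] bij_betw_inv_into_left)
  qed
qed

lemma quandle_iso_comp:
  "quandle_iso f Q Q' \<Longrightarrow> quandle_iso g Q' Q'' \<Longrightarrow> quandle_iso (\<lambda>x. g (f x)) Q Q''"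
  unfolding quandle_iso_def
  using bij_betw_trans[of f "carrier Q" "carrier Q'" g "carrier Q''"] bij_betw_apply[of f "carrier Q" "carrier Q'"]
  by (simp add: o_def)

lemma quandle_isomorphic_sym: "quandle Q \<Longrightarrow> Q \<cong>\<^sub>q Q' \<Longrightarrow> Q' \<cong>\<^sub>q Q"
  unfolding quandle_isomorphic_def using quandle_iso_inv by blast

lemma quandle_isomorphic_trans: "Q \<cong>\<^sub>q Q' \<Longrightarrow> Q' \<cong>\<^sub>q Q'' \<Longrightarrow> Q \<cong>\<^sub>q Q''"
  unfolding quandle_isomorphic_def using quandle_iso_comp by blast

lemma quandle_hom_iso:
  assumes "quandle_hom f Q Q'" "inj_on f (carrier Q)" "carrier Q' \<subseteq> f ` carrier Q"
  shows "quandle_iso f Q Q'"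
  using assms by (auto simp: quandle_iso_def bij_betw_def quandle_hom_def)

primrec interp :: "('a, 'm) quandle_struct_scheme \<Rightarrow> ('g \<Rightarrow> 'a) \<Rightarrow> 'g qterm \<Rightarrow> 'a" where
  "interp Q h (Gen g) = h g"
| "interp Q h (Act a b) = interp Q h a \<rhd>\<^bsub>Q\<^esub> interp Q h b"
| "interp Q h (Unact a b) = ldiv Q (interp Q h a) (interp Q h b)"

text \<open>Plain structural induction would let the induction hypotheses range over words in arbitrary
  generators, while \<open>interp\<close> is only meaningful on those over \<open>S\<close>.\<close>

lemma terms_over_induct [consumes 1, case_names Gen Act Unact]:
  assumes "a \<in> terms_over S"
    and "\<And>g. g \<in> S \<Longrightarrow> T (Gen g)"
    and "\<And>a b. \<lbrakk>a \<in> terms_over S; b \<in> terms_over S; T a; T b\<rbrakk> \<Longrightarrow> T (Act a b)"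
    and "\<And>a b. \<lbrakk>a \<in> terms_over S; b \<in> terms_over S; T a; T b\<rbrakk> \<Longrightarrow> T (Unact a b)"
  shows "T a"
  using assms(1) by (induction a) (auto intro: assms(2-4))

lemma interp_closed:
  assumes "quandle Q" "a \<in> terms_over S" "\<And>g. g \<in> S \<Longrightarrow> h g \<in> carrier Q"
  shows "interp Q h a \<in> carrier Q"
  using assms(2)
  by (induction rule: terms_over_induct)
     (auto simp: assms quandle.lact_closed[OF assms(1)] quandle.ldiv_closed[OF assms(1)])

lemma interp_cong:
  assumes "a \<in> terms_over S" "\<And>g. g \<in> S \<Longrightarrow> h g = h' g"
  shows "interp Q h a = interp Q h' a"
  using assms(1) by (induction rule: terms_over_induct) (auto simp: assms)

lemma interp_hom:
  assumes Q: "quandle Q" "quandle Q'" and f: "quandle_hom f Q Q'"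
    and a: "a \<in> terms_over S" and h: "\<And>g. g \<in> S \<Longrightarrow> h g \<in> carrier Q"
  shows "f (interp Q h a) = interp Q' (\<lambda>g. f (h g)) a"
  using a
  by (induction rule: terms_over_induct)
     (auto simp: quandle_hom_lact[OF f] quandle_hom_ldiv[OF Q f] interp_closed[OF Q(1) _ h])

lemma interp_qeq:
  assumes Q: "quandle Q" and h: "\<And>g. g \<in> generators X \<Longrightarrow> h g \<in> carrier Q"
    and rel: "\<And>a b. \<lbrakk>(a, b) \<in> relations X; a \<in> terms_over (generators X);
        b \<in> terms_over (generators X)\<rbrakk> \<Longrightarrow> interp Q h a = interp Q h b"
    and "qeq X a b"
  shows "interp Q h a = interp Q h b"
proof -
  note cl = interp_closed[OF Q _ h]
  show ?thesis
    using assms(4)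
  proof (induction rule: qeq.induct)
    case (qeq_rel a b)
    then show ?case by (rule rel)
  next
    case (qeq_Act_Unact a b)
    then show ?case by (simp add: cl quandle.lact_ldiv[OF Q])
  next
    case (qeq_Unact_Act a b)
    then show ?case by (simp add: cl quandle.ldiv_eqI[OF Q])
  next
    case (qeq_distrib a b c)
    then show ?case by (simp add: cl quandle.lact_distrib[OF Q])
  next
    case (qeq_idem a)
    then show ?case by (simp add: cl quandle.lact_idem[OF Q])
  qed auto
qed

text \<open>The homomorphism given by the universal property of \<open>presented X\<close>. The value does not depend on
  the chosen representative as soon as \<open>h\<close> satisfies the relations (\<open>lift_qclass\<close>).\<close>

definition lift :: "'g qpres \<Rightarrow> ('a, 'm) quandle_struct_scheme \<Rightarrow> ('g \<Rightarrow> 'a) \<Rightarrow> 'g qterm set \<Rightarrow> 'a" where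
  "lift X Q h A = interp Q h (SOME a. a \<in> A)"

definition satisfies :: "'g qpres \<Rightarrow> ('a, 'm) quandle_struct_scheme \<Rightarrow> ('g \<Rightarrow> 'a) \<Rightarrow> bool" where
  "satisfies X Q h \<longleftrightarrow> (\<forall>g\<in>generators X. h g \<in> carrier Q) \<and>
     (\<forall>a b. (a, b) \<in> relations X \<longrightarrow> a \<in> terms_over (generators X) \<longrightarrow>
        b \<in> terms_over (generators X) \<longrightarrow> interp Q h a = interp Q h b)"

lemma lift_qclass:
  assumes "quandle Q" "satisfies X Q h" "a \<in> terms_over (generators X)"
  shows "lift X Q h (qclass X a) = interp Q h a"
proof -
  have "a \<in> qclass X a"
    using assms(3) by (simp add: qclass_def qeq_refl)
  then have "qeq X a (SOME b. b \<in> qclass X a)"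
    using someI[of "\<lambda>b. b \<in> qclass X a"] by (simp add: qclass_def)
  then show ?thesis
    unfolding lift_def using interp_qeq[OF assms(1), of X h] assms(2)
    unfolding satisfies_def by fastforce
qed

lemma quandle_hom_lift:
  assumes "quandle Q" "satisfies X Q h"
  shows "quandle_hom (lift X Q h) (presented X) Q"
  using assms(2) interp_closed[OF assms(1), of _ "generators X" h]
  by (auto simp: quandle_hom_def presented_carrier presented_lact lift_qclass[OF assms] satisfies_def)

lemma presented_ldiv:
  assumes "a \<in> terms_over (generators X)" "b \<in> terms_over (generators X)"
  shows "ldiv (presented X) (qclass X a) (qclass X b) = qclass X (Unact a b)"
  using assms
  by (intro quandle.ldiv_eqI[OF quandle_presented])
     (auto simp: presented_lact presented_carrier qclass_eq_iff qeq_Act_Unact)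

lemma interp_presented:
  assumes "a \<in> terms_over S" "S \<subseteq> generators X"
  shows "interp (presented X) (\<lambda>g. qclass X (Gen g)) a = qclass X a"
proof -
  have sub: "b \<in> terms_over (generators X)" if "b \<in> terms_over S" for b
    using that assms(2) by (auto simp: terms_over_def)
  show ?thesis
    using assms(1)
    by (induction rule: terms_over_induct) (auto simp: presented_lact presented_ldiv sub)
qed

lemma Gen_closed: "g \<in> generators X \<Longrightarrow> qclass X (Gen g) \<in> carrier (presented X)"
  by (simp add: presented_carrier)

lemma quandle_hom_qclass:
  assumes "quandle Q" "quandle_hom f (presented X) Q" "a \<in> terms_over (generators X)"
  shows "f (qclass X a) = interp Q (\<lambda>g. f (qclass X (Gen g))) a"
  using interp_hom[OF quandle_presented assms(1,2,3), of "\<lambda>g. qclass X (Gen g)"]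
  by (simp add: interp_presented[OF assms(3)] Gen_closed)

lemma quandle_hom_eqI:
  assumes Q: "quandle Q" and f: "quandle_hom f (presented X) Q" and f': "quandle_hom f' (presented X) Q"
    and eq: "\<And>g. g \<in> generators X \<Longrightarrow> f (qclass X (Gen g)) = f' (qclass X (Gen g))"
    and x: "x \<in> carrier (presented X)"
  shows "f x = f' x"
proof -
  obtain a where a: "a \<in> terms_over (generators X)" "x = qclass X a"
    using x by (auto simp: presented_carrier)
  show ?thesis
    using quandle_hom_qclass[OF Q f a(1)] quandle_hom_qclass[OF Q f' a(1)] interp_cong[OF a(1) eq] a
    by simp
qed

text \<open>Induction over the words is done here once; later it suffices to exhibit a subquandle.\<close>

lemma subquandle_presented_top:
  assumes "subquandle U (presented X)" "\<And>g. g \<in> generators X \<Longrightarrow> qclass X (Gen g) \<in> U"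
  shows "carrier (presented X) \<subseteq> U"
proof -
  have "qclass X a \<in> U" if "a \<in> terms_over (generators X)" for a
    using that assms(1)
    by (induction rule: terms_over_induct)
       (auto simp: assms(2) subquandle_def presented_lact[symmetric] presented_ldiv[symmetric])
  then show ?thesis by (auto simp: presented_carrier)
qed

lemma subquandle_image:
  assumes "quandle Q" "quandle Q'" "quandle_hom f Q Q'"
  shows "subquandle (f ` carrier Q) Q'"
proof -
  have "f x \<rhd>\<^bsub>Q'\<^esub> f y \<in> f ` carrier Q" "ldiv Q' (f x) (f y) \<in> f ` carrier Q"
    if "x \<in> carrier Q" "y \<in> carrier Q" for x y
    using that quandle.lact_closed[OF assms(1)] quandle.ldiv_closed[OF assms(1)]
    by (auto simp: quandle_hom_lact[OF assms(3), symmetric] quandle_hom_ldiv[OF assms, symmetric])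
  then show ?thesis
    using quandle_hom_closed[OF assms(3)] by (auto simp: subquandle_def)
qed

lemma subquandle_vimage:
  assumes "quandle Q" "quandle Q'" "quandle_hom f Q Q'" "subquandle U Q'"
  shows "subquandle {x \<in> carrier Q. f x \<in> U} Q"
  using assms(4) quandle.lact_closed[OF assms(1)] quandle.ldiv_closed[OF assms(1)]
  by (auto simp: subquandle_def quandle_hom_lact[OF assms(3)] quandle_hom_ldiv[OF assms(1-3)])

section \<open>Thompson's quandle and its action on the line\<close>

lemma quandle_thompson: "quandle thompson"
  by (simp add: thompson_def quandle_presented)

lemma generators_thompson_pres [simp]: "generators thompson_pres = UNIV"
  by (simp add: thompson_pres_def)

lemma terms_over_UNIV [simp]: "a \<in> terms_over UNIV"
  by (simp add: terms_over_def)

lemma pgen_closed [simp]: "pgen k \<in> carrier thompson"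
  by (simp add: pgen_def thompson_def Gen_closed)

lemmas thompson_closed [simp] = quandle.lact_closed[OF quandle_thompson]

lemma pgen_lact_pgen: "j < k \<Longrightarrow> pgen j \<rhd>\<^bsub>thompson\<^esub> pgen k = pgen (Suc k)"
  unfolding pgen_def thompson_def
  by (subst presented_lact) (auto simp: qclass_eq_iff thompson_pres_def intro!: qeq_rel)

lemma satisfies_thompson_pres:
  assumes "\<And>k. h k \<in> carrier Q" "\<And>j k. j < k \<Longrightarrow> h j \<rhd>\<^bsub>Q\<^esub> h k = h (Suc k)"
  shows "satisfies thompson_pres Q h"
  using assms by (auto simp: satisfies_def thompson_pres_def)

abbreviation from_thompson ::
  "('a, 'm) quandle_struct_scheme \<Rightarrow> (nat \<Rightarrow> 'a) \<Rightarrow> nat qterm set \<Rightarrow> 'a" where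
  "from_thompson \<equiv> lift thompson_pres"

lemma from_thompson:
  assumes "quandle Q" "\<And>k. h k \<in> carrier Q" "\<And>j k. j < k \<Longrightarrow> h j \<rhd>\<^bsub>Q\<^esub> h k = h (Suc k)"
  shows "quandle_hom (from_thompson Q h) thompson Q" "from_thompson Q h (pgen k) = h k"
proof -
  have "satisfies thompson_pres Q h"
    using assms(2,3) by (rule satisfies_thompson_pres)
  then show "quandle_hom (from_thompson Q h) thompson Q" "from_thompson Q h (pgen k) = h k"
    using quandle_hom_lift[OF assms(1)] lift_qclass[OF assms(1), of thompson_pres h "Gen k"]
    by (simp_all add: thompson_def pgen_def)
qed

lemma thompson_hom_eqI:
  assumes "quandle Q" "quandle_hom f thompson Q" "quandle_hom f' thompson Q"
    "\<And>k. f (pgen k) = f' (pgen k)" "x \<in> carrier thompson"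
  shows "f x = f' x"
  using quandle_hom_eqI[OF assms(1), of f thompson_pres f' x] assms(2-)
  by (simp add: pgen_def thompson_def)

definition conj_quandle :: "('a \<Rightarrow> 'a) quandle_struct" where
  "conj_quandle = \<lparr>carrier = {f. bij f}, lact = (\<lambda>f g. f \<circ> g \<circ> inv f)\<rparr>"

lemma conj_quandle_simps [simp]:
  "f \<in> carrier conj_quandle \<longleftrightarrow> bij f" "f \<rhd>\<^bsub>conj_quandle\<^esub> g = f \<circ> g \<circ> inv f"
  by (simp_all add: conj_quandle_def)

lemma quandle_conj_quandle: "quandle conj_quandle"
proof
  fix f :: "'a \<Rightarrow> 'a" assume "f \<in> carrier conj_quandle"
  then have f: "bij f" by simp
  then have inv: "inv f (f y) = y" "f (inv f y) = y" for y
    by (auto simp: bij_is_inj bij_is_surj surj_f_inv_f)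
  show "f \<rhd>\<^bsub>conj_quandle\<^esub> f = f"
    by (simp add: fun_eq_iff inv)
  show "bij_betw (\<lambda>g. f \<rhd>\<^bsub>conj_quandle\<^esub> g) (carrier conj_quandle) (carrier conj_quandle)"
    by (rule bij_betw_byWitness[where f' = "\<lambda>g. inv f \<circ> g \<circ> f"])
       (auto simp: fun_eq_iff inv f bij_imp_bij_inv intro!: bij_comp)
next
  fix f g h :: "'a \<Rightarrow> 'a"
  assume "f \<in> carrier conj_quandle" "g \<in> carrier conj_quandle" "h \<in> carrier conj_quandle"
  then have fg: "bij f" "bij g" by auto
  then have "inv f (f y) = y" for y
    by (simp add: bij_is_inj)
  moreover have "inv (f \<circ> g \<circ> inv f) = f \<circ> inv g \<circ> inv f"
    using fg by (simp add: o_inv_distrib bij_comp bij_imp_bij_inv inv_inv_eq comp_assoc)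
  ultimately show "f \<rhd>\<^bsub>conj_quandle\<^esub> (g \<rhd>\<^bsub>conj_quandle\<^esub> h)
      = (f \<rhd>\<^bsub>conj_quandle\<^esub> g) \<rhd>\<^bsub>conj_quandle\<^esub> (f \<rhd>\<^bsub>conj_quandle\<^esub> h)"
    by (simp add: fun_eq_iff)
qed

text \<open>The standard generators of Thompson's group, as homeomorphisms of the line. The breakpoints are
  chosen such that translation by 1 carries each generator to the next one.\<close>

definition bump :: "nat \<Rightarrow> real \<Rightarrow> real" where
  "bump k y = (if y \<le> real k then y else if y \<le> real k + 1 then 2 * y - real k else y + 1)"

lemma bij_bump: "bij (bump k)"
proof (rule o_bij)
  let ?g = "\<lambda>y::real. if y \<le> k then y else if y \<le> k + 2 then (y + k) / 2 else y - 1"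
  show "?g \<circ> bump k = id" "bump k \<circ> ?g = id"
    by (auto simp: fun_eq_iff bump_def field_simps)
qed

lemma strict_mono_bump: "strict_mono (bump k)"
  by (rule strict_monoI) (auto simp: bump_def)

lemma bump_ge: "y \<le> bump k y"
  by (simp add: bump_def)

lemma bump_greater: "real k < y \<Longrightarrow> y < bump k y"
  by (simp add: bump_def)

lemma bump_fix: "y \<le> real k \<Longrightarrow> bump k y = y"
  by (simp add: bump_def)

text \<open>On the support of \<open>bump k\<close>, the map \<open>bump j\<close> is translation by 1, whence the relations of
  Thompson's quandle hold for conjugation.\<close>

lemma bump_bump: "j < k \<Longrightarrow> bump j (bump k y) = bump (Suc k) (bump j y)"
  by (auto simp: bump_def)

lemma bump_translate: "bump (k + j) (y + real j) = bump k y + real j"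
  by (auto simp: bump_def)

definition rep :: "nat qterm set \<Rightarrow> real \<Rightarrow> real" where
  "rep = from_thompson conj_quandle bump"

lemma bump_conj: "j < k \<Longrightarrow> bump j \<rhd>\<^bsub>conj_quandle\<^esub> bump k = bump (Suc k)"
  using bij_bump[of j] by (simp add: fun_eq_iff bump_bump bij_is_surj surj_f_inv_f)

lemma quandle_hom_rep: "quandle_hom rep thompson conj_quandle"
  and rep_pgen: "rep (pgen k) = bump k"
  unfolding rep_def
  using from_thompson[OF quandle_conj_quandle, of bump, OF _ bump_conj] by (simp_all add: bij_bump)

lemma rep_lact:
  assumes "a \<in> carrier thompson"
  shows "rep (pgen k \<rhd>\<^bsub>thompson\<^esub> a) (bump k y) = bump k (rep a y)"
  using bij_is_inj[OF bij_bump] assms by (simp add: quandle_hom_lact[OF quandle_hom_rep] rep_pgen)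

section \<open>Positive words and faithfulness of the action\<close>

definition word_act :: "nat list \<Rightarrow> nat qterm set \<Rightarrow> nat qterm set" where
  "word_act w a = foldr (\<lambda>k x. pgen k \<rhd>\<^bsub>thompson\<^esub> x) w a"

lemma word_act_simps [simp]:
  "word_act [] a = a"
  "word_act (k # w) a = pgen k \<rhd>\<^bsub>thompson\<^esub> word_act w a"
  "word_act (v @ w) a = word_act v (word_act w a)"
  by (simp_all add: word_act_def)

lemma word_act_closed [simp]: "a \<in> carrier thompson \<Longrightarrow> word_act w a \<in> carrier thompson"
  by (induction w) auto

lemma word_act_lact:
  "\<lbrakk>a \<in> carrier thompson; b \<in> carrier thompson\<rbrakk>
   \<Longrightarrow> word_act w (a \<rhd>\<^bsub>thompson\<^esub> b) = word_act w a \<rhd>\<^bsub>thompson\<^esub> word_act w b"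
proof (induction w)
  case (Cons k w)
  then show ?case
    using quandle.lact_distrib[OF quandle_thompson, of "pgen k" "word_act w a" "word_act w b"] by simp
qed simp

lemma word_act_inj:
  "\<lbrakk>word_act w a = word_act w b; a \<in> carrier thompson; b \<in> carrier thompson\<rbrakk> \<Longrightarrow> a = b"
  by (induction w) (auto dest: quandle.lact_cancel[OF quandle_thompson])

lemma word_act_surj:
  assumes "b \<in> carrier thompson"
  obtains a where "a \<in> carrier thompson" "b = word_act w a"
proof -
  have "\<exists>a\<in>carrier thompson. b = word_act w a"
    using assms
  proof (induction w arbitrary: b)
    case (Cons k w)
    obtain a where "a \<in> carrier thompson" "ldiv thompson (pgen k) b = word_act w a"
      using Cons.IH[of "ldiv thompson (pgen k) b"] Cons.prems
      by (auto simp: quandle.ldiv_closed[OF quandle_thompson])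
    then show ?case
      using quandle.lact_ldiv[OF quandle_thompson, of "pgen k" b] Cons.prems by auto
  qed auto
  then show ?thesis using that by blast
qed

text \<open>Self-distributivity turns the relations of the quandle into relations between left
  multiplications, those of Thompson's monoid.\<close>

lemma pgen_commute:
  assumes "j < k" "a \<in> carrier thompson"
  shows "pgen j \<rhd>\<^bsub>thompson\<^esub> (pgen k \<rhd>\<^bsub>thompson\<^esub> a)
    = pgen (Suc k) \<rhd>\<^bsub>thompson\<^esub> (pgen j \<rhd>\<^bsub>thompson\<^esub> a)"
  using assms by (simp add: quandle.lact_distrib[OF quandle_thompson, of "pgen j"] pgen_lact_pgen)

lemma pgen_word_act_commute:
  assumes "\<forall>i\<in>set w. j < i" "a \<in> carrier thompson"
  shows "pgen j \<rhd>\<^bsub>thompson\<^esub> word_act w a = word_act (map Suc w) (pgen j \<rhd>\<^bsub>thompson\<^esub> a)"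
  using assms by (induction w) (auto simp: pgen_commute)

text \<open>Two letters have a common left multiple in which each is multiplied by at most one letter. Keeping
  track of this bound is what lets the induction over \<open>u\<close> go through: moving the left factor past a
  letter never makes it longer.\<close>

lemma common_left_multiple_letter:
  assumes "length v \<le> 1"
  shows "\<exists>c d. length c \<le> 1 \<and>
    (\<forall>a\<in>carrier thompson. word_act c (word_act u a) = word_act d (word_act v a))"
  using assms
proof (induction u arbitrary: v rule: rev_induct)
  case Nil
  then show ?case by (intro exI[of _ v] exI[of _ "[]"]) auto
next
  case (snoc i u)
  have "\<exists>c d. length c \<le> 1 \<and> (\<forall>a\<in>carrier thompson. word_act c (word_act [i] a) = word_act d (word_act v a))"
  proof (cases v)
    case Nil
    then show ?thesis by (intro exI[of _ "[]"] exI[of _ "[i]"]) auto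
  next
    case (Cons j v')
    with snoc.prems have v: "v = [j]" by simp
    consider "i = j" | "i < j" | "j < i" by linarith
    then show ?thesis
    proof cases
      case 1
      then show ?thesis using v by (intro exI[of _ "[]"]) auto
    next
      case 2
      then show ?thesis using v
        by (intro exI[of _ "[Suc j]"] exI[of _ "[i]"]) (auto simp: pgen_commute)
    next
      case 3
      then show ?thesis using v
        by (intro exI[of _ "[j]"] exI[of _ "[Suc i]"]) (auto simp: pgen_commute)
    qed
  qed
  then obtain c d where cd: "length c \<le> 1"
    "\<And>a. a \<in> carrier thompson \<Longrightarrow> word_act c (word_act [i] a) = word_act d (word_act v a)"
    by blast
  obtain c' d' where "length c' \<le> 1"
    "\<And>a. a \<in> carrier thompson \<Longrightarrow> word_act c' (word_act u a) = word_act d' (word_act c a)"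
    using snoc.IH[OF cd(1)] by blast
  then show ?case
    using cd(2) by (intro exI[of _ c'] exI[of _ "d' @ d"]) auto
qed

text \<open>The Ore condition for Thompson's monoid, which makes its group one of left fractions.\<close>

lemma common_left_multiple:
  "\<exists>c d. \<forall>a\<in>carrier thompson. word_act c (word_act u a) = word_act d (word_act v a)"
proof (induction v arbitrary: u rule: rev_induct)
  case Nil
  then show ?case by (intro exI[of _ "[]"] exI[of _ u]) auto
next
  case (snoc j v)
  obtain c d where cd:
    "\<And>a. a \<in> carrier thompson \<Longrightarrow> word_act c (word_act u a) = word_act d (word_act [j] a)"
    using common_left_multiple_letter[of "[j]" u] by auto
  obtain c' d' where
    "\<And>a. a \<in> carrier thompson \<Longrightarrow> word_act c' (word_act d a) = word_act d' (word_act v a)"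
    using snoc.IH[of d] by blast
  then show ?case
    using cd by (intro exI[of _ "c' @ c"] exI[of _ d']) auto
qed

text \<open>Elements that can be reached from a generator by left multiplications alone, without their
  inverses.\<close>

definition positive :: "nat qterm set \<Rightarrow> bool" where
  "positive a \<longleftrightarrow> (\<exists>w k. a = word_act w (pgen k))"

lemma positive_word_act: "positive a \<Longrightarrow> positive (word_act w a)"
  unfolding positive_def by (metis word_act_simps(3))

text \<open>If \<open>x = v \<cdot> p\<^sub>k\<close>, then \<open>x\<close> acts as \<open>v p\<^sub>k v\<inverse>\<close>. A word \<open>c\<close> with \<open>c (v p\<^sub>k) = d v\<close> as actions
  therefore clears the inverse: \<open>c \<cdot> (x \<rhd> y) = d \<cdot> y\<close>. For the inverse of the
  left multiplication by \<open>x\<close> the roles of \<open>v p\<^sub>k\<close> and \<open>v\<close> are exchanged.\<close>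

lemma positive_lact:
  assumes "positive x" "positive y" "y \<in> carrier thompson"
  shows "\<exists>c. positive (word_act c (x \<rhd>\<^bsub>thompson\<^esub> y))"
    and "\<exists>c. positive (word_act c (ldiv thompson x y))"
proof -
  obtain v k where x: "x = word_act v (pgen k)"
    using assms(1) by (auto simp: positive_def)
  then have xC: "x \<in> carrier thompson" by simp
  have x_act: "x \<rhd>\<^bsub>thompson\<^esub> word_act v z = word_act (v @ [k]) z" if "z \<in> carrier thompson" for z
    using that by (simp add: x word_act_lact)
  show "\<exists>c. positive (word_act c (x \<rhd>\<^bsub>thompson\<^esub> y))"
  proof -
    obtain z where z: "z \<in> carrier thompson" "y = word_act v z"
      using word_act_surj[OF assms(3)] .
    obtain c d where "\<And>a. a \<in> carrier thompson \<Longrightarrow> word_act c (word_act (v @ [k]) a) = word_act d (word_act v a)"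
      using common_left_multiple by blast
    then have "word_act c (x \<rhd>\<^bsub>thompson\<^esub> y) = word_act d y"
      using z x_act by simp
    then show ?thesis using positive_word_act[OF assms(2)] by metis
  qed
  show "\<exists>c. positive (word_act c (ldiv thompson x y))"
  proof -
    have q: "ldiv thompson x y \<in> carrier thompson"
      using assms(3) xC by (simp add: quandle.ldiv_closed[OF quandle_thompson])
    obtain z where z: "z \<in> carrier thompson" "ldiv thompson x y = word_act v z"
      using word_act_surj[OF q] .
    have y: "y = word_act (v @ [k]) z"
      using quandle.lact_ldiv[OF quandle_thompson xC assms(3)] z x_act by simp
    obtain c d where "\<And>a. a \<in> carrier thompson \<Longrightarrow> word_act c (word_act v a) = word_act d (word_act (v @ [k]) a)"
      using common_left_multiple by blast
    then have "word_act c (ldiv thompson x y) = word_act d y"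
      using z y by simp
    then show ?thesis using positive_word_act[OF assms(2)] by metis
  qed
qed

lemma word_act_ldiv:
  assumes "a \<in> carrier thompson" "b \<in> carrier thompson"
  shows "word_act w (ldiv thompson a b) = ldiv thompson (word_act w a) (word_act w b)"
  using assms quandle_hom_ldiv[OF quandle_thompson quandle_thompson, of "word_act w" a b]
  by (simp add: quandle_hom_def word_act_lact)

lemma common_denominator:
  assumes "positive (word_act u x)" "positive (word_act v y)"
    "x \<in> carrier thompson" "y \<in> carrier thompson"
  shows "\<exists>w. positive (word_act w x) \<and> positive (word_act w y)"
proof -
  obtain c d where "\<And>a. a \<in> carrier thompson \<Longrightarrow> word_act c (word_act u a) = word_act d (word_act v a)"
    using common_left_multiple by blast
  then have "word_act (c @ u) y = word_act d (word_act v y)"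
    using assms(4) by simp
  then have "positive (word_act (c @ u) y)"
    using positive_word_act[OF assms(2)] by simp
  moreover have "positive (word_act (c @ u) x)"
    using positive_word_act[OF assms(1)] by simp
  ultimately show ?thesis by blast
qed

text \<open>By \<open>positive_lact\<close>, the elements that some word makes positive form a subquandle.\<close>

lemma exists_denominator:
  assumes "x \<in> carrier thompson"
  shows "\<exists>w. positive (word_act w x)"
proof -
  let ?U = "{x \<in> carrier thompson. \<exists>w. positive (word_act w x)}"
  have step: "\<exists>w. positive (word_act w (x \<rhd>\<^bsub>thompson\<^esub> y))" "\<exists>w. positive (word_act w (ldiv thompson x y))"
    if xy: "x \<in> ?U" "y \<in> ?U" for x y
  proof -
    obtain w where w: "positive (word_act w x)" "positive (word_act w y)"
      using xy common_denominator by blast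
    have "\<exists>c. positive (word_act c (word_act w (x \<rhd>\<^bsub>thompson\<^esub> y)))"
      "\<exists>c. positive (word_act c (word_act w (ldiv thompson x y)))"
      using positive_lact[OF w] xy by (auto simp: word_act_lact word_act_ldiv)
    then show "\<exists>w. positive (word_act w (x \<rhd>\<^bsub>thompson\<^esub> y))" "\<exists>w. positive (word_act w (ldiv thompson x y))"
      by (metis word_act_simps(3))+
  qed
  have "subquandle ?U thompson"
    unfolding subquandle_def using step by (auto simp: quandle.ldiv_closed[OF quandle_thompson])
  moreover have "pgen k \<in> ?U" for k
    unfolding positive_def by (auto intro!: exI[of _ "[]"])
  ultimately have "carrier thompson \<subseteq> ?U"
    using subquandle_presented_top[of ?U thompson_pres] by (simp add: thompson_def pgen_def)
  then show ?thesis using assms by blast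
qed

text \<open>Sorting by \<open>x\<^sub>j x\<^sub>i = x\<^sub>i\<^sub>+\<^sub>1 x\<^sub>j\<close> for \<open>j < i\<close>, so that the smallest index comes last and acts first.\<close>

primrec insort_desc :: "nat \<Rightarrow> nat list \<Rightarrow> nat list" where
  "insort_desc j [] = [j]"
| "insort_desc j (i # w) = (if i \<le> j then j # i # w else Suc i # insort_desc j w)"

lemma insort_desc_lower: "k < j \<Longrightarrow> \<forall>i\<in>set w. k < i \<Longrightarrow> \<forall>i\<in>set (insort_desc j w). k < i"
  by (induction w) auto

text \<open>A letter that is overtaken by a smaller one goes up by 1, but it stays in front of the letters
  that it bounded before.\<close>

lemma insort_desc_upper: "j \<le> Suc m \<Longrightarrow> \<forall>i\<in>set w. i \<le> m \<Longrightarrow> \<forall>i\<in>set (insort_desc j w). i \<le> Suc m"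
  by (induction w) (auto simp: le_SucI)

lemma sorted_insort_desc: "sorted_wrt (\<ge>) w \<Longrightarrow> sorted_wrt (\<ge>) (insort_desc j w)"
proof (induction w)
  case (Cons i w)
  then show ?case using insort_desc_upper[of j i w] by auto
qed auto

lemma word_act_insort_desc:
  "a \<in> carrier thompson \<Longrightarrow> word_act (insort_desc j w) a = word_act (j # w) a"
  by (induction w) (auto simp: pgen_commute)

text \<open>When a letter \<open>j\<close> is put in front of a normal form \<open>w \<cdot> p\<^sub>l\<close>, it can be sorted into \<open>w\<close> if
  \<open>j > l\<close>. Otherwise it passes all letters of \<open>w\<close>, which raises them by 1, and then disappears
  into \<open>p\<^sub>l\<close>, which becomes \<open>p\<^sub>l\<^sub>+\<^sub>1\<close> if \<open>j < l\<close> and is fixed if \<open>j = l\<close>.\<close>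

lemma positive_normal_form:
  assumes "positive x"
  obtains w k where "x = word_act w (pgen k)" "sorted_wrt (\<ge>) w" "\<forall>i\<in>set w. k < i"
proof -
  have "\<exists>w' l. word_act v (pgen k) = word_act w' (pgen l) \<and> sorted_wrt (\<ge>) w' \<and> (\<forall>i\<in>set w'. l < i)" for v k
  proof (induction v)
    case Nil
    then show ?case by (intro exI[of _ "[]"] exI[of _ k]) auto
  next
    case (Cons j v)
    then obtain w l where w: "word_act v (pgen k) = word_act w (pgen l)" "sorted_wrt (\<ge>) w" "\<forall>i\<in>set w. l < i"
      by blast
    have map: "sorted_wrt (\<ge>) (map Suc w)"
      using w(2) by (simp add: sorted_wrt_map)
    consider "l < j" | "j \<le> l" by linarith
    then show ?case
    proof cases
      case 1
      then show ?thesis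
        using w insort_desc_lower[of l j w] sorted_insort_desc[of w j]
        by (intro exI[of _ "insort_desc j w"] exI[of _ l]) (auto simp: word_act_insort_desc)
    next
      case 2
      then have "word_act (j # v) (pgen k) = word_act (map Suc w) (pgen j \<rhd>\<^bsub>thompson\<^esub> pgen l)"
        using w(1) pgen_word_act_commute[of w j "pgen l"] w(3) by fastforce
      moreover have "pgen j \<rhd>\<^bsub>thompson\<^esub> pgen l = pgen (if j = l then l else Suc l)"
        using 2 by (auto simp: quandle.lact_idem[OF quandle_thompson] pgen_lact_pgen)
      ultimately show ?thesis
        using w map
        by (intro exI[of _ "map Suc w"] exI[of _ "if j = l then l else Suc l"]) auto
    qed
  qed
  then show ?thesis
    using assms that unfolding positive_def by metis
qed

definition word_bump :: "nat list \<Rightarrow> real \<Rightarrow> real" where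
  "word_bump w = foldr bump w"

lemma word_bump_simps [simp]:
  "word_bump [] y = y" "word_bump (k # w) y = bump k (word_bump w y)"
  "word_bump (v @ w) y = word_bump v (word_bump w y)"
  by (simp_all add: word_bump_def)

lemma rep_word_act:
  "a \<in> carrier thompson \<Longrightarrow> rep (word_act w a) (word_bump w y) = word_bump w (rep a y)"
  by (induction w arbitrary: y) (auto simp: rep_lact)

lemma strict_mono_word_bump: "y < z \<Longrightarrow> word_bump w y < word_bump w z"
  by (induction w) (auto simp: strict_mono_less[OF strict_mono_bump])

lemma word_bump_ge: "y \<le> word_bump w y"
proof (induction w)
  case (Cons k w)
  then show ?case using bump_ge[of "word_bump w y" k] by simp
qed simp

lemma word_bump_fix: "\<forall>i\<in>set w. y \<le> real i \<Longrightarrow> word_bump w y = y"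
  by (induction w) (auto simp: bump_fix)

lemma word_bump_surj: "\<exists>z. y = word_bump w z"
proof (induction w arbitrary: y)
  case (Cons k w)
  then show ?case by simp (metis bij_bump bij_pointE)
qed simp

text \<open>The last letter of a sorted word is the point up to which its map is the identity, and beyond
  which every point moves to the right. So the map determines the last letter, which can be
  cancelled since letters act bijectively.\<close>

lemma word_bump_eq_imp_eq:
  assumes "sorted_wrt (\<ge>) v" "sorted_wrt (\<ge>) w" "word_bump v = word_bump w"
  shows "v = w"
  using assms
proof (induction v arbitrary: w rule: rev_induct)
  case Nil
  show ?case
  proof (cases w rule: rev_cases)
    case (snoc w' i)
    have "real i + 1 < word_bump w (real i + 1)"
      using bump_greater[of i "real i + 1"] word_bump_ge[of "bump i (real i + 1)" w'] by (simp add: snoc)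
    then show ?thesis
      using Nil(3) by (metis order_less_irrefl word_bump_simps(1))
  qed simp
next
  case (snoc j v)
  have last: "\<not> i < k" if "sorted_wrt (\<ge>) (u @ [i])" "sorted_wrt (\<ge>) (u' @ [k])"
    "word_bump (u @ [i]) = word_bump (u' @ [k])" for u u' i k
  proof
    assume "i < k"
    then have "real k < bump i (real k)"
      by (simp add: bump_greater)
    also have "\<dots> \<le> word_bump (u @ [i]) (real k)"
      by (simp add: word_bump_ge)
    also have "\<dots> = real k"
      using that(2) unfolding that(3) by (intro word_bump_fix) (auto simp: sorted_wrt_append)
    finally show False by simp
  qed
  show ?case
  proof (cases w rule: rev_cases)
    case Nil
    have "real j + 1 < word_bump (v @ [j]) (real j + 1)"
      using bump_greater[of j "real j + 1"] word_bump_ge[of "bump j (real j + 1)" v] by simp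
    then show ?thesis
      using snoc.prems(3) Nil by simp
  next
    case (snoc w' k)
    have jk: "j = k"
      using last[of v j w' k] last[of w' k v j] snoc.prems[unfolded snoc] by (metis linorder_neqE_nat)
    have "word_bump v y = word_bump w' y" for y
      using snoc.prems(3) jk bij_pointE[OF bij_bump[of j], of y]
      unfolding snoc by (metis word_bump_simps)
    then have "v = w'"
      using snoc.prems by (intro snoc.IH) (auto simp: snoc sorted_wrt_append)
    then show ?thesis using jk snoc by simp
  qed
qed

text \<open>For \<open>x = w \<cdot> p\<^sub>k\<close> in normal form, \<open>c = rep x\<close> is the conjugate of \<open>bump k\<close> by the map \<open>f\<close> of
  \<open>w\<close>. Since all letters of \<open>w\<close> exceed \<open>k\<close>, the map \<open>f\<close> is the identity up to \<open>k + 1\<close>, so \<open>k\<close> is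
  the point where \<open>c\<close> ceases to be the identity. Then \<open>f \<circ> bump k = c \<circ> f\<close> determines \<open>f\<close> step by
  step: \<open>bump k\<close> maps the half-line up to \<open>k + 1\<close> onto the one up to \<open>k + 2\<close>, and so on. By
  \<open>word_bump_eq_imp_eq\<close>, \<open>f\<close> determines \<open>w\<close>.\<close>

lemma rep_inj_positive:
  assumes "positive x" "positive y" "rep x = rep y"
  shows "x = y"
proof -
  obtain w k where x: "x = word_act w (pgen k)" "sorted_wrt (\<ge>) w" "\<forall>i\<in>set w. k < i"
    using positive_normal_form[OF assms(1)] .
  obtain v l where y: "y = word_act v (pgen l)" "sorted_wrt (\<ge>) v" "\<forall>i\<in>set v. l < i"
    using positive_normal_form[OF assms(2)] .
  define c where "c = rep x"
  have cw: "c (word_bump w z) = word_bump w (bump k z)" for z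
    unfolding c_def x(1) by (simp add: rep_word_act rep_pgen)
  have cv: "c (word_bump v z) = word_bump v (bump l z)" for z
    unfolding c_def assms(3) y(1) by (simp add: rep_word_act rep_pgen)
  have low: "word_bump u z = z" if "\<forall>i\<in>set u. m < i" "z \<le> real m + 1" for u z m
    by (rule word_bump_fix) (use that in fastforce)
  have index: "\<not> m < n"
    if "\<forall>i\<in>set u. m < i" "\<forall>i\<in>set u'. n < i"
      "\<And>z. c (word_bump u z) = word_bump u (bump m z)"
      "\<And>z. c (word_bump u' z) = word_bump u' (bump n z)" for m n u u'
  proof
    \<comment> \<open>\<open>c\<close> fixes everything up to \<open>n\<close>, but moves everything beyond \<open>m\<close>.\<close>
    assume "m < n"
    obtain z where z: "real n = word_bump u z"
      using word_bump_surj by blast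
    have "real m < z"
      using z low[OF that(1), of z] \<open>m < n\<close> by (cases "z \<le> real m") auto
    then have "real n < c (real n)"
      unfolding z that(3) by (simp add: strict_mono_word_bump bump_greater)
    moreover have "c (real n) = real n"
      using that(4)[of "real n"] low[OF that(2), of "real n"] by (simp add: bump_fix)
    ultimately show False by simp
  qed
  have kl: "k = l"
    using index[OF x(3) y(3) cw cv] index[OF y(3) x(3) cv cw] by linarith
  have agree: "\<forall>z \<le> real k + 1 + real n. word_bump w z = word_bump v z" for n
  proof (induction n)
    case 0
    then show ?case using low[OF x(3)] low[OF y(3)] kl by simp
  next
    case (Suc n)
    show ?case
    proof (intro allI impI)
      fix z assume z: "z \<le> real k + 1 + real (Suc n)"
      obtain z' where z': "z = bump k z'"
        using bij_pointE[OF bij_bump, of z k] by metis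
      have "z' \<le> real k + 1 + real n"
        using z unfolding z' by (auto simp: bump_def split: if_splits)
      then have "word_bump w z' = word_bump v z'"
        using Suc by blast
      then show "word_bump w z = word_bump v z"
        using cw[of z'] cv[of z'] kl z' by simp
    qed
  qed
  have "word_bump w z = word_bump v z" for z
  proof -
    obtain n where "z \<le> real n" using real_arch_simple by blast
    then show ?thesis using agree[of n] by auto
  qed
  then have "w = v"
    using x(2) y(2) by (intro word_bump_eq_imp_eq) auto
  then show ?thesis using x(1) y(1) kl by simp
qed

text \<open>Thompson's quandle embeds into the conjugation quandle of a group of homeomorphisms of the line.\<close>

theorem rep_inj: "inj_on rep (carrier thompson)"
proof (rule inj_onI)
  fix x y assume xy: "x \<in> carrier thompson" "y \<in> carrier thompson" "rep x = rep y"
  obtain w where w: "positive (word_act w x)" "positive (word_act w y)"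
    using exists_denominator common_denominator xy by metis
  have "rep (word_act w x) z = rep (word_act w y) z" for z
    using word_bump_surj[of z w] xy by (metis rep_word_act)
  then have "word_act w x = word_act w y"
    by (intro rep_inj_positive[OF w]) auto
  then show "x = y" using xy by (auto dest: word_act_inj)
qed

section \<open>The shifts\<close>

definition shift :: "nat \<Rightarrow> nat qterm set \<Rightarrow> nat qterm set" where
  "shift j = from_thompson thompson (\<lambda>k. pgen (k + j))"

lemma quandle_hom_shift: "quandle_hom (shift j) thompson thompson"
  and shift_pgen [simp]: "shift j (pgen k) = pgen (k + j)"
  unfolding shift_def
  using from_thompson[OF quandle_thompson, of "\<lambda>k. pgen (k + j)"] by (auto simp: pgen_lact_pgen)

text \<open>Both sides are homomorphisms into the conjugation quandle, as the right-hand side is \<open>rep\<close>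
  followed by conjugation with a translation; so it suffices to compare them on generators.\<close>

lemma rep_shift:
  assumes "x \<in> carrier thompson"
  shows "rep (shift j x) = (\<lambda>y. rep x (y - real j) + real j)"
proof -
  let ?T = "\<lambda>f y. f (y - real j) + real j"
  have bij: "bij (?T f)" and inv: "inv (?T f) = ?T (inv f)" if f: "bij f" for f :: "real \<Rightarrow> real"
  proof -
    have 1: "?T (inv f) \<circ> ?T f = id" "?T f \<circ> ?T (inv f) = id"
      using f by (auto simp: fun_eq_iff bij_is_inj bij_is_surj surj_f_inv_f)
    show "bij (?T f)" using 1 by (rule o_bij)
    show "inv (?T f) = ?T (inv f)" using 1 by (intro inv_unique_comp)
  qed
  have "quandle_hom ?T conj_quandle conj_quandle"
    by (auto simp: quandle_hom_def bij inv)
  then have "quandle_hom (\<lambda>x. ?T (rep x)) thompson conj_quandle"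
    by (rule quandle_hom_comp[OF quandle_hom_rep])
  moreover have "rep (shift j (pgen k)) = ?T (rep (pgen k))" for k
    using bump_translate[of k j] by (simp add: rep_pgen fun_eq_iff) (metis diff_add_cancel)
  ultimately show ?thesis
    using thompson_hom_eqI[OF quandle_conj_quandle quandle_hom_comp[OF quandle_hom_shift quandle_hom_rep]] assms
    by blast
qed

lemma shift_inj: "inj_on (shift j) (carrier thompson)"
proof (rule inj_onI)
  fix x y assume xy: "x \<in> carrier thompson" "y \<in> carrier thompson" "shift j x = shift j y"
  then have "rep x (z - real j) + real j = rep y (z - real j) + real j" for z
    by (metis rep_shift)
  from this[of "_ + real j"] have "rep x = rep y" by (simp add: fun_eq_iff)
  then show "x = y" using rep_inj xy by (auto dest: inj_onD)
qed

lemma carrier_thompson_sub: "carrier (thompson_sub j) = shift j ` carrier thompson"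
proof
  have "subquandle (shift j ` carrier thompson) thompson"
    by (rule subquandle_image[OF quandle_thompson quandle_thompson quandle_hom_shift])
  moreover have "{pgen k | k. j \<le> k} \<subseteq> shift j ` carrier thompson"
  proof safe
    fix k assume "j \<le> k"
    then show "pgen k \<in> shift j ` carrier thompson"
      by (intro image_eqI[of _ _ "pgen (k - j)"]) auto
  qed
  ultimately show "carrier (thompson_sub j) \<subseteq> shift j ` carrier thompson"
    by (auto simp: thompson_sub_def subquandle_generated_def)
  have "carrier thompson \<subseteq> {x \<in> carrier thompson. shift j x \<in> U}"
    if U: "subquandle U thompson" "{pgen k | k. j \<le> k} \<subseteq> U" for U
  proof -
    have "subquandle {x \<in> carrier thompson. shift j x \<in> U} thompson"
      by (rule subquandle_vimage[OF quandle_thompson quandle_thompson quandle_hom_shift U(1)])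
    moreover have "pgen k \<in> {x \<in> carrier thompson. shift j x \<in> U}" for k
      by (auto intro!: subsetD[OF U(2)])
    ultimately show ?thesis
      using subquandle_presented_top[of _ thompson_pres] by (simp add: thompson_def pgen_def)
  qed
  then show "shift j ` carrier thompson \<subseteq> carrier (thompson_sub j)"
    by (fastforce simp: thompson_sub_def subquandle_generated_def)
qed

lemma lact_thompson_sub [simp]: "x \<rhd>\<^bsub>thompson_sub j\<^esub> y = x \<rhd>\<^bsub>thompson\<^esub> y"
  by (simp add: thompson_sub_def)

lemma quandle_thompson_sub: "quandle (thompson_sub j)"
  using quandle.quandle_subquandle[OF quandle_thompson
      subquandle_image[OF quandle_thompson quandle_thompson quandle_hom_shift], of j]
    carrier_thompson_sub[of j]
  by (simp add: thompson_sub_def)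

lemma quandle_iso_shift: "quandle_iso (shift j) thompson (thompson_sub j)"
  using quandle_hom_shift[of j] shift_inj[of j]
  by (auto intro!: quandle_hom_iso simp: quandle_hom_def carrier_thompson_sub)

lemma thompson_sub_isomorphic: "thompson_sub j \<cong>\<^sub>q thompson"
  using quandle_iso_inv[OF quandle_thompson quandle_iso_shift]
  by (auto simp: quandle_isomorphic_def)

lemma shift_add:
  assumes "x \<in> carrier thompson"
  shows "shift i (shift j x) = shift (i + j) x"
  by (rule thompson_hom_eqI[OF quandle_thompson quandle_hom_comp[OF quandle_hom_shift quandle_hom_shift]
        quandle_hom_shift _ assms]) (simp add: ac_simps)

lemma thompson_sub_0: "thompson_sub 0 = thompson"
proof -
  have "quandle_hom (\<lambda>x. x) thompson thompson"
    by (simp add: quandle_hom_def)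
  then have "shift 0 x = x" if "x \<in> carrier thompson" for x
    using thompson_hom_eqI[OF quandle_thompson quandle_hom_shift, of "\<lambda>x. x" 0 x] that by simp
  then have "carrier (thompson_sub 0) = carrier thompson"
    by (auto simp: carrier_thompson_sub)
  then show ?thesis by (simp add: thompson_sub_def)
qed

lemma thompson_shift_exists: "\<exists>\<tau>. thompson_shift j \<tau>"
proof -
  let ?\<tau> = "\<lambda>x. shift (j + 1) (inv_into (carrier thompson) (shift j) x)"
  have "quandle_iso ?\<tau> (thompson_sub j) (thompson_sub (j + 1))"
    by (rule quandle_iso_comp[OF quandle_iso_inv[OF quandle_thompson quandle_iso_shift] quandle_iso_shift])
  moreover have "?\<tau> (pgen k) = pgen (k + 1)" if "j \<le> k" for k
  proof -
    have "inv_into (carrier thompson) (shift j) (pgen k) = pgen (k - j)"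
      using that by (intro inv_into_f_eq[OF shift_inj]) auto
    then show ?thesis using that by simp
  qed
  ultimately show ?thesis by (auto simp: thompson_shift_def)
qed

lemma thompson_shift_shift:
  assumes "thompson_shift j \<tau>" "x \<in> carrier thompson"
  shows "\<tau> (shift j x) = shift (Suc j) x"
proof (rule thompson_hom_eqI[OF quandle_thompson_sub _ _ _ assms(2)])
  have "quandle_iso \<tau> (thompson_sub j) (thompson_sub (Suc j))"
    using assms(1) by (simp add: thompson_shift_def)
  then show "quandle_hom (\<lambda>x. \<tau> (shift j x)) thompson (thompson_sub (Suc j))"
    by (intro quandle_iso_imp_hom quandle_iso_comp[OF quandle_iso_shift])
  show "quandle_hom (shift (Suc j)) thompson (thompson_sub (Suc j))"
    by (rule quandle_iso_imp_hom[OF quandle_iso_shift])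
  show "\<tau> (shift j (pgen k)) = shift (Suc j) (pgen k)" for k
    using assms(1) by (simp add: thompson_shift_def)
qed

text \<open>The generator \<open>p\<^sub>0\<close> acts on \<open>P\<^sub>1\<close> as the shift: two homomorphisms that agree on generators.\<close>

lemma pgen_0_lact_shift:
  assumes "x \<in> carrier thompson"
  shows "pgen 0 \<rhd>\<^bsub>thompson\<^esub> shift 1 x = shift 2 x"
proof (rule thompson_hom_eqI[OF quandle_thompson _ quandle_hom_shift _ assms])
  have s: "shift 1 x \<in> carrier thompson" if "x \<in> carrier thompson" for x
    using that by (rule quandle_hom_closed[OF quandle_hom_shift])
  show "quandle_hom (\<lambda>x. pgen 0 \<rhd>\<^bsub>thompson\<^esub> shift 1 x) thompson thompson"
    unfolding quandle_hom_def
    using quandle.lact_distrib[OF quandle_thompson pgen_closed[of 0] s s]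
    by (simp add: s[simplified] quandle_hom_lact[OF quandle_hom_shift])
  show "pgen 0 \<rhd>\<^bsub>thompson\<^esub> shift 1 (pgen k) = shift 2 (pgen k)" for k
    by (simp add: pgen_lact_pgen)
qed

section \<open>HNN extensions\<close>

lemma generators_hnn_pres [simp]: "generators (hnn_pres X \<theta> U \<tau> t) = insert t (generators X)"
  by (simp add: hnn_pres_def)

lemma wf_hnn_pres:
  assumes "wf_pres X"
  shows "wf_pres (hnn_pres X \<theta> U \<tau> t)"
proof -
  have "terms_over (generators X) \<subseteq> terms_over (insert t (generators X))"
    by (auto simp: terms_over_def)
  then show ?thesis
    using assms unfolding wf_pres_def by (fastforce simp: hnn_pres_def)
qed

text \<open>With \<open>P\<^sub>j\<close> identified with \<open>P\<close> by the shift, \<open>\<tau>\<close> becomes the shift of \<open>P\<close>, and the base of the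
  extension is identified with \<open>P\<^sub>1 \<subseteq> P\<close> by another shift. The homomorphism \<open>A\<close> from the extension
  to \<open>P\<close> is this identification on the base and sends the stable letter \<open>t\<close> to \<open>p\<^sub>0\<close>; its inverse
  \<open>B\<close> sends \<open>p\<^sub>0\<close> to \<open>t\<close> and the other generators to the base.\<close>

theorem hnn_pres_isomorphic:
  assumes \<tau>: "thompson_shift j \<tau>" and X: "presents X \<theta> (thompson_sub j)" and t: "t \<notin> generators X"
  shows "thompson \<cong>\<^sub>q presented (hnn_pres X \<theta> (carrier (thompson_sub j)) \<tau> t)"
proof -
  define Y where "Y = hnn_pres X \<theta> (carrier (thompson_sub j)) \<tau> t"
  have genY: "generators Y = insert t (generators X)"
    by (simp add: Y_def)
  have XY: "a \<in> terms_over (generators Y)" if "a \<in> terms_over (generators X)" for a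
    using that by (auto simp: genY terms_over_def)
  have isoX: "quandle_iso \<theta> (presented X) (thompson_sub j)"
    using X by (simp add: presents_def)
  then have bijX: "bij_betw \<theta> (carrier (presented X)) (carrier (thompson_sub j))"
    by (simp add: quandle_iso_def)
  \<comment> \<open>\<open>\<eta>\<close> and \<open>\<kappa>\<close> are the identification of \<open>P\<close> with the quandle presented by \<open>X\<close>, in both directions.\<close>
  define \<eta> where "\<eta> x = inv_into (carrier (presented X)) \<theta> (shift j x)" for x
  define \<kappa> where "\<kappa> x = inv_into (carrier thompson) (shift j) (\<theta> x)" for x
  have hom_\<eta>: "quandle_hom \<eta> thompson (presented X)"
    unfolding \<eta>_def
    by (intro quandle_iso_imp_hom quandle_iso_comp[OF quandle_iso_shift quandle_iso_inv[OF quandle_presented isoX]])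
  have hom_\<kappa>: "quandle_hom \<kappa> (presented X) thompson"
    unfolding \<kappa>_def
    by (intro quandle_iso_imp_hom quandle_iso_comp[OF isoX quandle_iso_inv[OF quandle_thompson quandle_iso_shift]])
  have \<theta>_\<eta>: "\<theta> (\<eta> x) = shift j x" if "x \<in> carrier thompson" for x
    using quandle_hom_closed[OF quandle_iso_imp_hom[OF quandle_iso_shift] that]
    by (simp add: \<eta>_def bij_betw_inv_into_right[OF bijX])
  have \<theta>_\<kappa>: "\<theta> x = shift j (\<kappa> x)" if "x \<in> carrier (presented X)" for x
    using quandle_hom_closed[OF quandle_iso_imp_hom[OF isoX] that] carrier_thompson_sub[of j]
    by (simp add: \<kappa>_def f_inv_into_f)
  have \<kappa>_\<eta>: "\<kappa> (\<eta> x) = x" if "x \<in> carrier thompson" for x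
    using that shift_inj[of j] by (simp add: \<kappa>_def \<theta>_\<eta>)
  have \<eta>_\<kappa>: "\<eta> (\<kappa> x) = x" if "x \<in> carrier (presented X)" for x
    by (simp add: \<eta>_def \<theta>_\<kappa>[OF that, symmetric] bij_betw_inv_into_left[OF bijX that])

  have interp_XY: "interp (presented Y) (\<lambda>g. qclass Y (Gen g)) a = qclass Y a"
    if "a \<in> terms_over (generators X)" for a
    using interp_presented[OF that, of Y] genY by blast
  have satX: "satisfies X (presented Y) (\<lambda>g. qclass Y (Gen g))"
    unfolding satisfies_def
  proof (intro conjI ballI allI impI, goal_cases)
    case (1 g)
    then show ?case by (simp add: Gen_closed genY)
  next
    case (2 a b)
    then have "qeq Y a b"
      using XY by (intro qeq_rel) (auto simp: Y_def hnn_pres_def)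
    then show ?case
      using 2 XY by (simp add: interp_XY qclass_eq_iff)
  qed
  \<comment> \<open>\<open>\<iota>\<close> reads words in the generators of the base as words in those of the extension.\<close>
  define \<iota> where "\<iota> = lift X (presented Y) (\<lambda>g. qclass Y (Gen g))"
  have hom_\<iota>: "quandle_hom \<iota> (presented X) (presented Y)"
    unfolding \<iota>_def by (rule quandle_hom_lift[OF quandle_presented satX])
  have \<iota>: "\<iota> (qclass X a) = qclass Y a" if "a \<in> terms_over (generators X)" for a
    using that unfolding \<iota>_def
    by (simp add: lift_qclass[OF quandle_presented satX] interp_XY)
  define \<beta> where "\<beta> x = \<iota> (\<eta> x)" for x
  have hom_\<beta>: "quandle_hom \<beta> thompson (presented Y)"
    unfolding \<beta>_def by (rule quandle_hom_comp[OF hom_\<eta> hom_\<iota>])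
  \<comment> \<open>These are the defining relations of the extension, for the images of the generators.\<close>
  have t_\<beta>: "qclass Y (Gen t) \<rhd>\<^bsub>presented Y\<^esub> \<beta> (pgen k) = \<beta> (pgen (Suc k))" for k
  proof -
    obtain a b where a: "a \<in> terms_over (generators X)" "\<eta> (pgen k) = qclass X a"
      and b: "b \<in> terms_over (generators X)" "\<eta> (pgen (Suc k)) = qclass X b"
      using quandle_hom_closed[OF hom_\<eta> pgen_closed] unfolding presented_carrier by blast
    have "\<theta> (qclass X a) = pgen (k + j)" "\<theta> (qclass X b) = pgen (Suc k + j)"
      using \<theta>_\<eta>[of "pgen k"] \<theta>_\<eta>[of "pgen (Suc k)"] by (simp_all add: a(2) b(2))
    moreover have "\<tau> (pgen (k + j)) = pgen (Suc k + j)"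
      using \<tau> by (simp add: thompson_shift_def)
    moreover have "pgen (k + j) \<in> carrier (thompson_sub j)"
      unfolding carrier_thompson_sub by (metis imageI pgen_closed shift_pgen)
    ultimately have "\<theta> (qclass X a) \<in> carrier (thompson_sub j)" "\<theta> (qclass X b) = \<tau> (\<theta> (qclass X a))"
      by simp_all
    then have "qeq Y (Act (Gen t) a) b"
      using a(1) b(1) XY by (intro qeq_rel) (auto simp: Y_def hnn_pres_def)
    then show ?thesis
      using a b XY by (simp add: \<beta>_def \<iota> presented_lact qclass_eq_iff genY)
  qed
  define B where "B = from_thompson (presented Y) (\<lambda>k. case k of 0 \<Rightarrow> qclass Y (Gen t) | Suc k \<Rightarrow> \<beta> (pgen k))"
  have "(case j of 0 \<Rightarrow> qclass Y (Gen t) | Suc k \<Rightarrow> \<beta> (pgen k)) \<rhd>\<^bsub>presented Y\<^esub>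
      (case k of 0 \<Rightarrow> qclass Y (Gen t) | Suc k \<Rightarrow> \<beta> (pgen k)) = \<beta> (pgen k)" if "j < k" for j k
    using that by (auto split: nat.split simp: t_\<beta> quandle_hom_lact[OF hom_\<beta>, symmetric] pgen_lact_pgen)
  then have hom_B: "quandle_hom B thompson (presented Y)" and B_0: "B (pgen 0) = qclass Y (Gen t)"
    and B_Suc: "B (pgen (Suc k)) = \<beta> (pgen k)" for k
    unfolding B_def
    using from_thompson[OF quandle_presented,
        of "\<lambda>k. case k of 0 \<Rightarrow> qclass Y (Gen t) | Suc k \<Rightarrow> \<beta> (pgen k)" Y]
    by (auto split: nat.split simp: Gen_closed genY quandle_hom_closed[OF hom_\<beta>])
  have B_shift: "B (shift 1 x) = \<beta> x" if "x \<in> carrier thompson" for x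
    by (rule thompson_hom_eqI[OF quandle_presented quandle_hom_comp[OF quandle_hom_shift hom_B] hom_\<beta> _ that])
       (simp add: B_Suc)

  define h where "h g = (if g = t then pgen 0 else shift 1 (\<kappa> (qclass X (Gen g))))" for g
  have h_t: "h t = pgen 0"
    by (simp add: h_def)
  have hom_s\<kappa>: "quandle_hom (\<lambda>x. shift 1 (\<kappa> x)) (presented X) thompson"
    by (rule quandle_hom_comp[OF hom_\<kappa> quandle_hom_shift])
  have h_X: "interp thompson h a = shift 1 (\<kappa> (qclass X a))" if "a \<in> terms_over (generators X)" for a
  proof -
    have "h g = shift 1 (\<kappa> (qclass X (Gen g)))" if "g \<in> generators X" for g
      using that t by (auto simp: h_def)
    then show ?thesis
      unfolding quandle_hom_qclass[OF quandle_thompson hom_s\<kappa> that] by (rule interp_cong[OF that])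
  qed
  have satY: "satisfies Y thompson h"
    unfolding satisfies_def
  proof (intro conjI ballI allI impI, goal_cases)
    case (1 g)
    then show ?case
      using quandle_hom_closed[OF hom_s\<kappa> Gen_closed] by (auto simp: genY h_def)
  next
    case (2 a b)
    consider (base) "(a, b) \<in> relations X"
      | (stable) a' where "a = Act (Gen t) a'" "a' \<in> terms_over (generators X)"
        "b \<in> terms_over (generators X)" "\<theta> (qclass X b) = \<tau> (\<theta> (qclass X a'))"
      using 2 by (auto simp: Y_def hnn_pres_def)
    then show ?case
    proof cases
      case base
      then have ab: "a \<in> terms_over (generators X)" "b \<in> terms_over (generators X)"
        using X by (auto simp: presents_def wf_pres_def)
      then have "qclass X a = qclass X b"
        using base by (simp add: qclass_eq_iff qeq_rel)
      then show ?thesis using ab by (simp add: h_X)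
    next
      case stable
      let ?x = "\<kappa> (qclass X a')" and ?y = "\<kappa> (qclass X b)"
      have cl: "qclass X a' \<in> carrier (presented X)" "qclass X b \<in> carrier (presented X)"
        using stable by (auto simp: presented_carrier)
      then have x: "?x \<in> carrier thompson" and y: "?y \<in> carrier thompson"
        using quandle_hom_closed[OF hom_\<kappa>] by auto
      have "shift j ?y = shift (Suc j) ?x"
        using stable(4) cl thompson_shift_shift[OF \<tau> x] by (simp add: \<theta>_\<kappa>)
      also have "\<dots> = shift j (shift 1 ?x)"
        using x by (simp add: shift_add)
      finally have "?y = shift 1 ?x"
        using shift_inj[of j] x y quandle_hom_closed[OF quandle_hom_shift x] by (auto dest: inj_onD)
      then have "interp thompson h b = shift 1 (shift 1 ?x)"
        using stable by (simp add: h_X)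
      also have "\<dots> = pgen 0 \<rhd>\<^bsub>thompson\<^esub> shift 1 ?x"
        unfolding pgen_0_lact_shift[OF x] shift_add[OF x] one_add_one ..
      also have "\<dots> = interp thompson h a"
        using stable by (simp add: h_X h_t)
      finally show ?thesis ..
    qed
  qed
  define A where "A = lift Y thompson h"
  have hom_A: "quandle_hom A (presented Y) thompson"
    unfolding A_def by (rule quandle_hom_lift[OF quandle_thompson satY])
  have A: "A (qclass Y a) = interp thompson h a" if "a \<in> terms_over (generators Y)" for a
    unfolding A_def by (rule lift_qclass[OF quandle_thompson satY that])
  have A_\<iota>: "A (\<iota> x) = shift 1 (\<kappa> x)" if "x \<in> carrier (presented X)" for x
    using that by (auto simp: presented_carrier \<iota> A XY h_X)
  have A_B_pgen: "A (B (pgen k)) = pgen k" for k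
  proof (cases k)
    case 0
    then show ?thesis by (simp add: B_0 A genY h_t)
  next
    case (Suc k')
    then show ?thesis
      using quandle_hom_closed[OF hom_\<eta>] by (simp add: B_Suc \<beta>_def A_\<iota> \<kappa>_\<eta>)
  qed
  have A_B: "A (B x) = x" if "x \<in> carrier thompson" for x
    by (rule thompson_hom_eqI[OF quandle_thompson quandle_hom_comp[OF hom_B hom_A] _ _ that])
       (simp_all add: A_B_pgen quandle_hom_def)

  have "quandle_iso B thompson (presented Y)"
  proof (rule quandle_hom_iso[OF hom_B])
    show "inj_on B (carrier thompson)"
      using A_B by (rule inj_on_inverseI)
    show "carrier (presented Y) \<subseteq> B ` carrier thompson"
    proof (rule subquandle_presented_top)
      show "subquandle (B ` carrier thompson) (presented Y)"
        by (rule subquandle_image[OF quandle_thompson quandle_presented hom_B])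
      fix g assume "g \<in> generators Y"
      then consider "g = t" | "g \<in> generators X" by (auto simp: genY)
      then show "qclass Y (Gen g) \<in> B ` carrier thompson"
      proof cases
        case 1
        then show ?thesis using B_0 by (metis imageI pgen_closed)
      next
        case 2
        let ?x = "\<kappa> (qclass X (Gen g))"
        have x: "?x \<in> carrier thompson"
          using quandle_hom_closed[OF hom_\<kappa> Gen_closed[OF 2]] .
        have "qclass Y (Gen g) = B (shift 1 ?x)"
          unfolding B_shift[OF x] using 2 by (simp add: \<beta>_def \<eta>_\<kappa> Gen_closed \<iota>)
        then show ?thesis
          using quandle_hom_closed[OF quandle_hom_shift x] by blast
      qed
    qed
  qed
  then show ?thesis
    unfolding quandle_isomorphic_def Y_def by blast
qed

lemma hnn_pres_thompson_sub:
  assumes "thompson_shift j \<tau>" "presents X \<theta> (thompson_sub j)" "t \<notin> generators X"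
  shows "presented (hnn_pres X \<theta> (carrier (thompson_sub j)) \<tau> t) \<cong>\<^sub>q thompson_sub i"
  using quandle_isomorphic_sym[OF quandle_thompson hnn_pres_isomorphic[OF assms]]
    quandle_isomorphic_sym[OF quandle_thompson_sub thompson_sub_isomorphic, of i]
  by (rule quandle_isomorphic_trans)

text \<open>A tower of height \<open>n\<close> over the natural numbers consumes \<open>n\<close> new generators. Starting with the
  generators \<open>n, n + 1, \<dots>\<close> leaves exactly the indices below \<open>n\<close> for them.\<close>

lemma presentation_away_from_initial_segment:
  "\<exists>(X :: nat qpres) \<theta>. presents X \<theta> (thompson_sub j) \<and> generators X = {n..}"
proof -
  define X :: "nat qpres" where
    "X = \<lparr>generators = {n..}, relations = {(Act (Gen i) (Gen k), Gen (Suc k)) | i k. n \<le> i \<and> i < k}\<rparr>"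
  have gen: "generators X = {n..}" by (simp add: X_def)
  have wf: "wf_pres X" by (auto simp: wf_pres_def X_def)
  have sat: "satisfies X thompson (\<lambda>k. pgen (k - n))"
    unfolding satisfies_def
  proof (intro conjI ballI allI impI)
    fix a b assume "(a, b) \<in> relations X"
    then obtain i k where ik: "n \<le> i" "i < k" "a = Act (Gen i) (Gen k)" "b = Gen (Suc k)"
      by (auto simp: X_def)
    then have "Suc k - n = Suc (k - n)" "i - n < k - n" by auto
    then show "interp thompson (\<lambda>k. pgen (k - n)) a = interp thompson (\<lambda>k. pgen (k - n)) b"
      using ik by (simp add: pgen_lact_pgen)
  qed simp
  define f where "f = lift X thompson (\<lambda>k. pgen (k - n))"
  have hom_f: "quandle_hom f (presented X) thompson"
    unfolding f_def by (rule quandle_hom_lift[OF quandle_thompson sat])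
  have f: "f (qclass X (Gen k)) = pgen (k - n)" if "n \<le> k" for k
    using lift_qclass[OF quandle_thompson sat, of "Gen k"] that by (simp add: f_def gen)
  have rel: "qclass X (Gen (i + n)) \<rhd>\<^bsub>presented X\<^esub> qclass X (Gen (k + n)) = qclass X (Gen (Suc k + n))"
    if "i < k" for i k
  proof -
    have "(Act (Gen (i + n)) (Gen (k + n)), Gen (Suc k + n)) \<in> relations X"
      using that by (simp add: X_def)
    then have "qeq X (Act (Gen (i + n)) (Gen (k + n))) (Gen (Suc k + n))"
      by (rule qeq_rel) (simp_all add: gen)
    then show ?thesis by (simp add: presented_lact qclass_eq_iff gen)
  qed
  have cl: "qclass X (Gen (k + n)) \<in> carrier (presented X)" for k
    by (simp add: Gen_closed gen)
  define g where "g = from_thompson (presented X) (\<lambda>k. qclass X (Gen (k + n)))"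
  have hom_g: "quandle_hom g thompson (presented X)" and g: "g (pgen k) = qclass X (Gen (k + n))" for k
    unfolding g_def
    using from_thompson[OF quandle_presented, of "\<lambda>k. qclass X (Gen (k + n))" X, OF cl rel] by blast+
  have id: "quandle_hom (\<lambda>x. x) Q Q" for Q :: "'z quandle_struct"
    by (simp add: quandle_hom_def)
  have fg: "f (g x) = x" if "x \<in> carrier thompson" for x
    using thompson_hom_eqI[OF quandle_thompson quandle_hom_comp[OF hom_g hom_f], of "\<lambda>x. x", OF id _ that]
    by (simp add: f g)
  have gf: "g (f x) = x" if "x \<in> carrier (presented X)" for x
    using quandle_hom_eqI[OF quandle_presented quandle_hom_comp[OF hom_f hom_g], of "\<lambda>x. x", OF id _ that]
    by (simp add: f g gen)
  have "quandle_iso f (presented X) thompson"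
  proof (rule quandle_hom_iso[OF hom_f])
    show "inj_on f (carrier (presented X))"
      using gf by (rule inj_on_inverseI)
    show "carrier thompson \<subseteq> f ` carrier (presented X)"
    proof
      fix x assume "x \<in> carrier thompson"
      then show "x \<in> f ` carrier (presented X)"
        using fg[of x] quandle_hom_closed[OF hom_g, of x] by (intro image_eqI[of _ _ "g x"]) simp_all
    qed
  qed
  then have "presents X (\<lambda>x. shift j (f x)) (thompson_sub j)"
    unfolding presents_def using wf quandle_iso_comp[OF _ quandle_iso_shift] by blast
  then show ?thesis using gen by blast
qed

text \<open>The new generators are \<open>n - 1, \<dots>, 0\<close> in this order. The identification of each level with
  \<open>P\<^sub>n\<^sub>-\<^sub>i\<close> exists by \<open>hnn_pres_thompson_sub\<close>, but it must be chosen before the next extension can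
  be formed, hence the dependent choice.\<close>

lemma thompson_hnn_tower_exists:
  assumes \<tau>: "\<forall>j\<in>{1..n}. thompson_shift j (\<tau> j)"
  shows "\<exists>(X :: nat \<Rightarrow> nat qpres) \<theta> t. thompson_hnn_tower n \<tau> X \<theta> t"
proof -
  define T :: "nat \<Rightarrow> nat qpres \<times> (nat qterm set \<Rightarrow> nat qterm set) \<Rightarrow> bool" where
    "T i Z \<longleftrightarrow> presents (fst Z) (snd Z) (thompson_sub (n - i)) \<and> generators (fst Z) = {n - i..}" for i Z
  define H :: "nat \<Rightarrow> nat qpres \<times> (nat qterm set \<Rightarrow> nat qterm set) \<Rightarrow> nat qpres" where
    "H i Z = hnn_pres (fst Z) (snd Z) (carrier (thompson_sub (n - i))) (\<tau> (n - i)) (n - Suc i)" for i Z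
  have "\<exists>f. \<forall>i. T i (f i) \<and> (i < n \<longrightarrow> fst (f (Suc i)) = H i (f i))"
  proof (rule dependent_nat_choice[where P = T and Q = "\<lambda>i Z Z'. i < n \<longrightarrow> fst Z' = H i Z"])
    obtain X :: "nat qpres" and \<theta> where "presents X \<theta> (thompson_sub n)" "generators X = {n..}"
      using presentation_away_from_initial_segment[of n n] by (elim exE conjE)
    then have "T 0 (X, \<theta>)" by (simp add: T_def)
    then show "\<exists>Z. T 0 Z" ..
  next
    fix Z i assume Z: "T i Z"
    show "\<exists>Z'. T (Suc i) Z' \<and> (i < n \<longrightarrow> fst Z' = H i Z)"
    proof (cases "i < n")
      case True
      have sub: "thompson_shift (n - i) (\<tau> (n - i))"
        by (rule bspec[OF \<tau>]) (use True in auto)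
      have "presented (H i Z) \<cong>\<^sub>q thompson_sub (n - Suc i)"
        unfolding H_def
        by (rule hnn_pres_thompson_sub[OF sub]) (use Z True in \<open>simp_all add: T_def\<close>)
      then obtain \<theta> where "quandle_iso \<theta> (presented (H i Z)) (thompson_sub (n - Suc i))"
        unfolding quandle_isomorphic_def ..
      moreover have "wf_pres (H i Z)"
        using Z by (simp add: H_def T_def presents_def wf_hnn_pres)
      moreover have "generators (H i Z) = {n - Suc i..}"
      proof -
        have "generators (fst Z) = {n - i..}"
          using Z by (simp add: T_def)
        then show ?thesis
          using True by (auto simp: H_def)
      qed
      ultimately have "T (Suc i) (H i Z, \<theta>)"
        by (simp add: T_def presents_def)
      then show ?thesis by (intro exI[of _ "(H i Z, \<theta>)"]) simp
    next
      case False
      then have "n - Suc i = n - i" by simp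
      then have "T (Suc i) Z"
        using Z unfolding T_def by metis
      then show ?thesis using False by (intro exI[of _ Z]) simp
    qed
  qed
  then obtain f where f: "\<forall>i. T i (f i) \<and> (i < n \<longrightarrow> fst (f (Suc i)) = H i (f i))" ..
  have "thompson_hnn_tower n \<tau> (\<lambda>i. fst (f i)) (\<lambda>i. snd (f i)) (\<lambda>i. n - Suc i)"
    unfolding thompson_hnn_tower_def
  proof (intro allI impI conjI)
    fix i assume i: "i < n"
    show "presents (fst (f i)) (snd (f i)) (thompson_sub (n - i))" "n - Suc i \<notin> generators (fst (f i))"
      using f i by (simp_all add: T_def)
    show "fst (f (Suc i)) = hnn_pres (fst (f i)) (snd (f i)) (carrier (thompson_sub (n - i)))
        (\<tau> (n - i)) (n - Suc i)"
      using f i by (simp add: H_def)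
  qed
  then show ?thesis by (intro exI)
qed

lemma thompson_hnn_tower_top:
  assumes "n \<ge> 1" "\<forall>j\<in>{1..n}. thompson_shift j (\<tau> j)" "thompson_hnn_tower n \<tau> X \<theta> t"
  shows "presented (X n) \<cong>\<^sub>q thompson"
proof -
  obtain m where n: "n = Suc m" using assms(1) by (cases n) auto
  then show ?thesis
    using assms(2,3) hnn_pres_thompson_sub[of 1 "\<tau> 1" "X m" "\<theta> m" "t m" 0]
    by (auto simp: thompson_hnn_tower_def thompson_sub_0)
qed

theorem mainTheorem4:
  shows
    "(\<forall>j. \<exists>\<tau>. thompson_shift j \<tau>) \<and>
     (\<forall>j\<ge>1. \<forall>\<tau> (X :: 'g qpres) \<theta> t.
        thompson_shift j \<tau> \<and> presents X \<theta> (thompson_sub j) \<and> t \<notin> generators X \<longrightarrow>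
        presented (hnn_pres X \<theta> (carrier (thompson_sub j)) \<tau> t) \<cong>\<^sub>q thompson_sub (j - 1)) \<and>
     thompson = thompson_sub 0 \<and>
     (\<forall>\<tau> (X :: 'g qpres) \<theta> t.
        thompson_shift 1 \<tau> \<and> presents X \<theta> (thompson_sub 1) \<and> t \<notin> generators X \<longrightarrow>
        thompson \<cong>\<^sub>q presented (hnn_pres X \<theta> (carrier (thompson_sub 1)) \<tau> t)) \<and>
     (\<forall>n\<ge>1. thompson_sub n \<cong>\<^sub>q thompson \<and>
        (\<forall>\<tau>. (\<forall>j\<in>{1..n}. thompson_shift j (\<tau> j)) \<longrightarrow>
           (\<exists>(X :: nat \<Rightarrow> nat qpres) \<theta> t. thompson_hnn_tower n \<tau> X \<theta> t \<and>
              presented (X n) \<cong>\<^sub>q thompson) \<and>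
           (\<forall>(X :: nat \<Rightarrow> 'g qpres) \<theta> t. thompson_hnn_tower n \<tau> X \<theta> t \<longrightarrow>
              presented (X n) \<cong>\<^sub>q thompson))) \<and>
     (\<forall>\<tau> (X :: 'g qpres) \<theta> t.
        thompson_shift 0 \<tau> \<and> presents X \<theta> thompson \<and> t \<notin> generators X \<longrightarrow>
        presented (hnn_pres X \<theta> (carrier thompson) \<tau> t) \<cong>\<^sub>q thompson)"
proof (intro conjI allI impI, goal_cases)
  case (1 j)
  show ?case by (rule thompson_shift_exists)
next
  case (2 j \<tau> X \<theta> t)
  then show ?case by (intro hnn_pres_thompson_sub) auto
next
  case 3
  show ?case by (simp add: thompson_sub_0)
next
  case (4 \<tau> X \<theta> t)
  then show ?case by (intro hnn_pres_isomorphic) auto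
next
  case (5 n)
  show ?case by (rule thompson_sub_isomorphic)
next
  case (6 n \<tau>)
  then show ?case using thompson_hnn_tower_exists[of n \<tau>] thompson_hnn_tower_top[of n \<tau>] by metis
next
  case (7 n \<tau> X \<theta> t)
  then show ?case by (intro thompson_hnn_tower_top) auto
next
  case (8 \<tau> X \<theta> t)
  then show ?case using hnn_pres_thompson_sub[of 0 \<tau> X \<theta> t 0] by (auto simp: thompson_sub_0)
qed

end
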